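(* For every $n\in\mathbb{N}$ there is a polytope $\Pi_n$ with extension complexity $\mathcal{O}(\mathrm{poly}(n))$ such that a Minkowski summand of $\Pi_n$ has extension complexity $2^{\Omega(n)}$.
   Context: Polyhedra are finite intersections of closed halfspaces; polytopes are bounded polyhedra. For a polyhedron $Q$, $h(Q)$ denotes its number of facets. The extension complexity of a polytope $P$ is $\operatorname{xc}(P)=\min\{h(Q)\mid Q \text{ a polyhedron and } \pi \text{ an affine map with } \pi(Q)=P\}$. A polytope $P$ is a Minkowski summand of a polytope $R$ if there is a polytope $Q$ with $P+Q=R$, where $P+Q=\{p+q\mid p\in P,q\in Q\}$. The asymptotic bounds are for $n\to\infty$. In the paper, $\Pi_n$ is the notation for the regular permutahedron $\Pi_n=\operatorname{conv}\{(\sigma(1),\dots,\sigma(n))\mid\sigma\text{ a permutation of }\{1,\dots,n\}\}\subseteq\mathbb{R}^n$. *)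

theory Defs
  imports
    "HOL-Analysis.Analysis"
    "HOL-Analysis.Finite_Function_Topology"
    "HOL-Combinatorics.Permutations"
    "HOL-Library.Landau_Symbols"
begin

text \<open>
  The dimension \<open>n\<close> is quantified inside the statement (and inside the definition of extension
  complexity), so it cannot be a type. All spaces \<open>\<real>\<^sup>n\<close> are therefore subspaces of the real normed
  space of finitely supported functions \<open>nat \<Rightarrow>\<^sub>0 real\<close>: \<open>\<real>\<^sup>n\<close> consists of the functions supported on
  the coordinates \<open>1, \<dots>, n\<close>. Convexity, faces, linear dimension, linear maps and boundedness are
  the library notions in that ambient space. Its norm is the \<open>\<ell>\<^sub>1\<close> norm.
\<close>

type_synonym rvec = "nat \<Rightarrow>\<^sub>0 real"

definition Rn :: "nat \<Rightarrow> rvec set" where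
  "Rn n = {x. Poly_Mapping.keys x \<subseteq> {1..n}}"

definition dot :: "nat \<Rightarrow> rvec \<Rightarrow> rvec \<Rightarrow> real" where
  "dot n a x = (\<Sum>i\<in>{1..n}. Poly_Mapping.lookup a i * Poly_Mapping.lookup x i)"

definition closed_halfspace_in :: "nat \<Rightarrow> rvec set \<Rightarrow> bool" where
  "closed_halfspace_in n H \<longleftrightarrow> (\<exists>a\<in>Rn n. \<exists>b. a \<noteq> 0 \<and> H = {x \<in> Rn n. dot n a x \<le> b})"

text \<open>The intersection with \<open>Rn n\<close> makes the empty intersection equal to the whole of \<open>\<real>\<^sup>n\<close>.\<close>

definition polyhedron_in :: "nat \<Rightarrow> rvec set \<Rightarrow> bool" where
  "polyhedron_in n Q \<longleftrightarrow>
     (\<exists>\<H>. finite \<H> \<and> (\<forall>H\<in>\<H>. closed_halfspace_in n H) \<and> Q = Rn n \<inter> \<Inter>\<H>)"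

definition polytope_in :: "nat \<Rightarrow> rvec set \<Rightarrow> bool" where
  "polytope_in n P \<longleftrightarrow> polyhedron_in n P \<and> bounded P"

text \<open>
  The library's \<^const>\<open>aff_dim\<close> and \<^const>\<open>facet_of\<close> are restricted to \<^class>\<open>euclidean_space\<close>;
  these are the same notions for subsets of some \<open>\<real>\<^sup>n\<close> in the ambient space.
\<close>

definition affine_dimension :: "rvec set \<Rightarrow> int" where
  "affine_dimension S = (if S = {} then -1 else int (dim {x - y |x y. x \<in> S \<and> y \<in> S}))"

definition is_facet_of :: "rvec set \<Rightarrow> rvec set \<Rightarrow> bool" where
  "is_facet_of F Q \<longleftrightarrow>
     F face_of Q \<and> F \<noteq> {} \<and> affine_dimension F = affine_dimension Q - 1"

definition num_facets :: "rvec set \<Rightarrow> nat" where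
  "num_facets Q = card {F. is_facet_of F Q}"

text \<open>
  Every affine map between some \<open>\<real>\<^sup>m\<close> and \<open>\<real>\<^sup>n\<close> extends to an affine map of the ambient space, and
  an affine map of the ambient space with \<open>\<pi> ` Q \<subseteq> \<real>\<^sup>n\<close> for \<open>Q \<subseteq> \<real>\<^sup>m\<close> agrees on \<open>Q\<close> with an affine
  map from \<open>\<real>\<^sup>m\<close> to \<open>\<real>\<^sup>n\<close> (compose with the coordinate projection).
\<close>

definition affine_map :: "(rvec \<Rightarrow> rvec) \<Rightarrow> bool" where
  "affine_map \<pi> \<longleftrightarrow> (\<exists>L c. linear L \<and> \<pi> = (\<lambda>x. L x + c))"

definition xc :: "rvec set \<Rightarrow> nat" where
  "xc P = (LEAST k. \<exists>m Q \<pi>. polyhedron_in m Q \<and> affine_map \<pi> \<and> \<pi> ` Q = P \<and> k = num_facets Q)"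

definition minkowski_sum :: "rvec set \<Rightarrow> rvec set \<Rightarrow> rvec set" where
  "minkowski_sum P Q = {p + q |p q. p \<in> P \<and> q \<in> Q}"

definition minkowski_summand_in :: "nat \<Rightarrow> rvec set \<Rightarrow> rvec set \<Rightarrow> bool" where
  "minkowski_summand_in n P R \<longleftrightarrow>
     polytope_in n P \<and> (\<exists>Q. polytope_in n Q \<and> minkowski_sum P Q = R)"

definition permutahedron :: "nat \<Rightarrow> rvec set" where
  "permutahedron n =
     convex hull {\<Sum>i\<in>{1..n}. Poly_Mapping.single i (real (\<sigma> i)) |\<sigma>. \<sigma> permutes {1..n}}"

end

theory Submission
  imports Defs "HOL-Real_Asymp.Real_Asymp"
begin

text \<open>
  The permutahedron is the base polytope of the strictly submodular function \<open>h T = top_sum n |T|\<close>, and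
  a linear image of the Birkhoff polytope, which has \<open>O(n\<^sup>2)\<close> facets. Since \<open>h\<close> has submodularity
  gap at least \<open>1\<close> on incomparable pairs, \<open>(h \<plusminus> \<delta>) / 2\<close> is submodular for every perturbation \<open>\<delta>\<close>
  with oscillation at most \<open>1/2\<close>, and the two base polytopes add up to the permutahedron. Taking \<open>\<delta>\<close>
  to be half the indicator of a family \<open>A\<close> of nonempty sets gives doubly exponentially many summands.

  Few of them can have small extension complexity, by a variant of Rothvoss's counting argument. If \<open>f\<close> is the
  set function of such a summand and its extension complexity is at most \<open>K\<close>, then Farkas' lemma gives a
  nonnegative factorization \<open>f T - x(T) = \<Lambda>\<^sub>T \<sqdot> y\<close> with bounded entries. Among the rows
  \<open>(1\<^sub>T, \<Lambda>\<^sub>T, f T)\<close> there are \<open>D = n + K + 1\<close> of which every other row is a combination with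
  small coefficients, so these \<open>D\<close> rows, rounded to a fine grid, already determine \<open>f\<close>. Hence
  \<open>2^(2^n - 1)\<close> is at most \<open>2^(8 D^3)\<close>.
\<close>

section \<open>Farkas lemma and spanning rows with small coefficients\<close>

text \<open>Extensions cannot be counted directly: they have real coefficients and arbitrary ambient
  dimension, so there are uncountably many. A factorization leaves finitely many numbers, but
  rounding them is harmless only if both the entries and the recombination coefficients are bounded;
  this is why slacks are rescaled and why spanning rows are chosen with largest pivots. Set
  functions of two families that differ at a set differ there by 1/4, so a total error below 1/4
  suffices, and a grid of width \<open>1 / (4 * (K + 1) * 2 ^ D)\<close> achieves it. Each of the
  \<open>K\<close> entries of a row then costs O(D) bits, which explains the cubic exponent.
  Extension complexity counts facets, not inequalities, so equations must cost nothing. Hence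
  Farkas' lemma is used relative to an affine subspace, and a polyhedron is described inside its
  affine hull by at most as many inequalities as it has facets.\<close>

text \<open>Bartl's induction: if dropping the constraint \<open>a k\<close> loses the implication, a violating point
  allows projecting along it onto the kernel of \<open>a k\<close>.\<close>

lemma farkas:
  fixes a :: "'i \<Rightarrow> 'a::real_vector \<Rightarrow> real" and g :: "'a \<Rightarrow> real"
  assumes "finite I" and U: "subspace U"
    and "\<And>i. i \<in> I \<Longrightarrow> linear (a i)" and "linear g"
    and "\<And>x. x \<in> U \<Longrightarrow> (\<And>i. i \<in> I \<Longrightarrow> a i x \<le> 0) \<Longrightarrow> g x \<le> 0"
  shows "\<exists>l. (\<forall>i\<in>I. l i \<ge> 0) \<and> (\<forall>x\<in>U. g x = (\<Sum>i\<in>I. l i * a i x))"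
  using assms(1,3-)
proof (induction I arbitrary: a g rule: finite_induct)
  case empty
  have "g x = 0" if "x \<in> U" for x
  proof -
    have "g (- x) \<le> 0" using empty.prems(3)[of "- x"] subspace_neg[OF U that] by auto
    moreover have "g x \<le> 0" using empty.prems(3)[of x] that by auto
    ultimately show ?thesis using linear_neg[OF empty.prems(2), of x] by auto
  qed
  then show ?case by auto
next
  case (insert k I)
  note lin = insert.prems(1) and ling = insert.prems(2)
  show ?case
  proof (cases "\<forall>x\<in>U. (\<forall>i\<in>I. a i x \<le> 0) \<longrightarrow> g x \<le> 0")
    case True
    then obtain l where l: "\<forall>i\<in>I. l i \<ge> 0" "\<forall>x\<in>U. g x = (\<Sum>i\<in>I. l i * a i x)"
      using insert.IH[of a g] lin ling by blast
    show ?thesis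
      using l insert.hyps
      by (intro exI[of _ "l(k := 0)"]) (auto intro!: sum.cong)
  next
    case False
    then obtain z where z: "z \<in> U" "\<And>i. i \<in> I \<Longrightarrow> a i z \<le> 0" "g z > 0"
      by (auto simp: not_le)
    have akz: "a k z > 0"
    proof (rule ccontr)
      assume "\<not> a k z > 0"
      then have "g z \<le> 0" by (intro insert.prems(3)[OF z(1)]) (use z(2) in auto)
      then show False using z(3) by simp
    qed
    \<comment> \<open>Scaled to \<open>a k x0 = 1\<close>, so that subtracting
      \<open>a k x *\<^sub>R x0\<close> projects \<open>x\<close> onto the kernel of
      \<open>a k\<close>.\<close>
    define x0 where "x0 = (1 / a k z) *\<^sub>R z"
    have x0: "x0 \<in> U" "\<And>i. i \<in> I \<Longrightarrow> a i x0 \<le> 0" "g x0 > 0" "a k x0 = 1"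
      unfolding x0_def using z akz lin ling U
      by (auto simp: linear_cmul subspace_scale divide_nonpos_pos)
    define a' where "a' i = (\<lambda>x. a i x - a i x0 * a k x)" for i
    define g' where "g' = (\<lambda>x. g x - g x0 * a k x)"
    have proj: "a' i x = a i (x - a k x *\<^sub>R x0)" if "i \<in> insert k I" for i x
      unfolding a'_def using lin[OF that] by (simp add: linear_diff linear_cmul)
    have projg: "g' x = g (x - a k x *\<^sub>R x0)" for x
      unfolding g'_def using ling by (simp add: linear_diff linear_cmul)
    have "\<exists>l. (\<forall>i\<in>I. l i \<ge> 0) \<and> (\<forall>x\<in>U. g' x = (\<Sum>i\<in>I. l i * a' i x))"
    proof (rule insert.IH)
      show "linear (a' i)" if "i \<in> I" for i
        using lin[of i] lin[of k] that unfolding a'_def linear_iff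
        by (auto simp: algebra_simps)
      show "linear g'"
        using lin[of k] ling unfolding g'_def linear_iff by (auto simp: algebra_simps)
      show "g' x \<le> 0" if x: "x \<in> U" and le: "\<And>i. i \<in> I \<Longrightarrow> a' i x \<le> 0" for x
        unfolding projg
      proof (rule insert.prems(3))
        show "x - a k x *\<^sub>R x0 \<in> U" using x x0(1) U by (simp add: subspace_diff subspace_scale)
        show "a i (x - a k x *\<^sub>R x0) \<le> 0" if "i \<in> insert k I" for i
        proof (cases "i = k")
          case True
          then show ?thesis using lin[of k] x0(4) by (simp add: linear_diff linear_cmul)
        next
          case False
          then show ?thesis using le[of i] proj[of i x] that by auto
        qed
      qed
    qed
    then obtain l where l: "\<forall>i\<in>I. l i \<ge> 0" "\<forall>x\<in>U. g' x = (\<Sum>i\<in>I. l i * a' i x)" by blast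
    \<comment> \<open>The multiplier of \<open>a k\<close> is what remains of \<open>g x0\<close>
      after the projected functionals are expanded; it is nonnegative because
      \<open>g x0 > 0\<close> while \<open>x0\<close> satisfies the constraints in
      \<open>I\<close>.\<close>
    define m where "m = g x0 - (\<Sum>i\<in>I. l i * a i x0)"
    have "m \<ge> 0"
    proof -
      have "(\<Sum>i\<in>I. l i * a i x0) \<le> 0"
        by (rule sum_nonpos) (use l(1) x0(2) in \<open>auto intro: mult_nonneg_nonpos\<close>)
      then show ?thesis using x0(3) unfolding m_def by simp
    qed
    moreover have "g x = (\<Sum>i\<in>I. l i * a i x) + m * a k x" if "x \<in> U" for x
    proof -
      have "g x = g x0 * a k x + (\<Sum>i\<in>I. l i * a' i x)"
        using l(2) that unfolding g'_def by (metis add_diff_cancel_left' diff_add_cancel add.commute)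
      also have "(\<Sum>i\<in>I. l i * a' i x) = (\<Sum>i\<in>I. l i * a i x) - (\<Sum>i\<in>I. l i * a i x0) * a k x"
        unfolding a'_def by (simp add: algebra_simps sum_subtractf sum_distrib_left)
      finally show ?thesis unfolding m_def by (simp add: algebra_simps)
    qed
    moreover have "(\<Sum>i\<in>I. (l(k := m)) i * a i x) = (\<Sum>i\<in>I. l i * a i x)" for x
      using insert.hyps by (intro sum.cong) auto
    ultimately show ?thesis
      using l(1) insert.hyps by (intro exI[of _ "l(k := m)"]) (auto simp del: fun_upd_apply, auto)
  qed
qed

text \<open>Homogenization: for \<open>t > 0\<close> the pair \<open>(d, t)\<close> stands for the
  point \<open>p + (1/t) *\<^sub>R d\<close>, and for \<open>t = 0\<close> for a direction in which
  the feasible set recedes. The constraint \<open>t \<ge> 0\<close>, indexed by \<open>None\<close>,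
  contributes the constant \<open>l0\<close>. Only displacements in \<open>L\<close> are tested, so
  \<open>L\<close> itself takes no multipliers.\<close>

lemma affine_farkas:
  fixes a :: "'i \<Rightarrow> 'a::real_vector \<Rightarrow> real" and g :: "'a \<Rightarrow> real"
  assumes "finite I" and L: "subspace L"
    and lin: "\<And>i. i \<in> I \<Longrightarrow> linear (a i)" and ling: "linear g"
    and p: "\<And>i. i \<in> I \<Longrightarrow> a i p \<le> b i"
    and valid: "\<And>x. x - p \<in> L \<Longrightarrow> (\<And>i. i \<in> I \<Longrightarrow> a i x \<le> b i) \<Longrightarrow> g x \<le> c"
  shows "\<exists>l l0. (\<forall>i\<in>I. l i \<ge> 0) \<and> l0 \<ge> 0 \<and>
      (\<forall>x. x - p \<in> L \<longrightarrow> c - g x = (\<Sum>i\<in>I. l i * (b i - a i x)) + l0)"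
proof -
  define J where "J = insert None (Some ` I)"
  define A :: "'i option \<Rightarrow> 'a \<times> real \<Rightarrow> real" where
    "A j = (\<lambda>(d, t). case j of None \<Rightarrow> - t | Some i \<Rightarrow> a i d - t * (b i - a i p))" for j
  define G where "G = (\<lambda>(d, t). g d - t * (c - g p))"
  have "\<exists>l. (\<forall>i\<in>J. l i \<ge> 0) \<and> (\<forall>x\<in>L \<times> UNIV. G x = (\<Sum>i\<in>J. l i * A i x))"
  proof (rule farkas)
    show "finite J" unfolding J_def using \<open>finite I\<close> by simp
    show "subspace (L \<times> (UNIV::real set))" using L by (intro subspace_Times) auto
    show "linear (A j)" if "j \<in> J" for j
      using that lin unfolding J_def A_def linear_iff
      by (fastforce simp: algebra_simps split: option.splits)
    show "linear G" using ling unfolding G_def linear_iff by (auto simp: algebra_simps)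
    fix y :: "'a \<times> real" assume yL: "y \<in> L \<times> UNIV" and yA: "\<And>j. j \<in> J \<Longrightarrow> A j y \<le> 0"
    obtain d t where y: "y = (d, t)" by (cases y)
    have d: "d \<in> L" using yL y by auto
    have t: "t \<ge> 0" using yA[of None] y unfolding J_def A_def by auto
    have le: "a i d \<le> t * (b i - a i p)" if "i \<in> I" for i
      using yA[of "Some i"] that y unfolding J_def A_def by auto
    show "G y \<le> 0"
    proof (cases "t = 0")
      case True
      \<comment> \<open>The whole ray from the feasible point \<open>p\<close> in direction
        \<open>d\<close> is feasible, so \<open>g\<close> is bounded above on it and cannot increase
        along \<open>d\<close>.\<close>
      have "g p + r * g d \<le> c" if "r \<ge> 0" for r
      proof -
        have "g (p + r *\<^sub>R d) \<le> c"
        proof (rule valid)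
          show "p + r *\<^sub>R d - p \<in> L" using d L by (simp add: subspace_scale)
          show "a i (p + r *\<^sub>R d) \<le> b i" if i: "i \<in> I" for i
          proof -
            have "r * a i d \<le> 0" using le[OF i] True \<open>r \<ge> 0\<close> by (simp add: mult_nonneg_nonpos)
            then show ?thesis using p[OF i] lin[OF i] by (simp add: linear_add linear_cmul)
          qed
        qed
        then show ?thesis using ling by (simp add: linear_add linear_cmul)
      qed
      then have bd: "r * g d \<le> c - g p" if "r \<ge> 0" for r using that by (smt (verit))
      have "g d \<le> 0"
      proof (rule ccontr)
        assume "\<not> g d \<le> 0"
        then have "g d > 0" by simp
        moreover have "c - g p \<ge> 0" using bd[of 0] by simp
        ultimately show False
          using bd[of "(c - g p + 1) / g d"] by (simp add: field_simps)
      qed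
      then show ?thesis unfolding G_def y True by simp
    next
      case False
      with t have t: "t > 0" by simp
      have "g (p + (1/t) *\<^sub>R d) \<le> c"
      proof (rule valid)
        show "p + (1/t) *\<^sub>R d - p \<in> L" using d L by (simp add: subspace_scale)
        show "a i (p + (1/t) *\<^sub>R d) \<le> b i" if i: "i \<in> I" for i
          using le[OF i] lin[OF i] t by (simp add: linear_add linear_cmul field_simps)
      qed
      then show ?thesis
        using ling t unfolding G_def y by (simp add: linear_add linear_cmul field_simps)
    qed
  qed
  then obtain l where l: "\<forall>j\<in>J. l j \<ge> 0" "\<forall>x\<in>L \<times> UNIV. G x = (\<Sum>j\<in>J. l j * A j x)" by blast
  have "c - g x = (\<Sum>i\<in>I. l (Some i) * (b i - a i x)) + l None" if x: "x - p \<in> L" for x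
  proof -
    have "G (x - p, 1) = (\<Sum>j\<in>J. l j * A j (x - p, 1))" using l(2) x by auto
    also have "\<dots> = - l None + (\<Sum>i\<in>I. l (Some i) * A (Some i) (x - p, 1))"
      unfolding J_def using \<open>finite I\<close> by (simp add: sum.reindex A_def)
    also have "(\<Sum>i\<in>I. l (Some i) * A (Some i) (x - p, 1)) = - (\<Sum>i\<in>I. l (Some i) * (b i - a i x))"
      unfolding sum_negf[symmetric] A_def
      by (rule sum.cong) (use lin in \<open>auto simp: linear_diff algebra_simps\<close>)
    finally show ?thesis using ling unfolding G_def by (simp add: linear_diff)
  qed
  then show ?thesis using l(1) unfolding J_def
    by (intro exI[of _ "\<lambda>i. l (Some i)"] exI[of _ "l None"]) auto
qed

text \<open>Gaussian elimination, pivoting on the entry of largest absolute value in the last column.\<close>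

lemma bounded_spanner:
  fixes v :: "'i \<Rightarrow> nat \<Rightarrow> real"
  assumes X: "finite X" "X \<noteq> {}"
  shows "\<exists>e. (\<forall>j<D. e j \<in> X) \<and>
    (\<forall>z\<in>X. \<exists>c. (\<forall>i<D. v z i = (\<Sum>j<D. c j * v (e j) i)) \<and> (\<Sum>j<D. \<bar>c j\<bar>) \<le> 2 ^ D - 1)"
proof (induction D arbitrary: v)
  case 0
  then show ?case by auto
next
  case (Suc D)
  obtain x where x: "x \<in> X" "\<And>z. z \<in> X \<Longrightarrow> \<bar>v z D\<bar> \<le> \<bar>v x D\<bar>"
  proof -
    have "Max ((\<lambda>z. \<bar>v z D\<bar>) ` X) \<in> (\<lambda>z. \<bar>v z D\<bar>) ` X" using X by (intro Max_in) auto
    then obtain x where "x \<in> X" "Max ((\<lambda>z. \<bar>v z D\<bar>) ` X) = \<bar>v x D\<bar>" by auto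
    then show ?thesis using that[of x] X by (metis Max_ge finite_imageI image_eqI)
  qed
  \<comment> \<open>If the last column vanishes on \<open>X\<close>, division by zero gives
    \<open>t z = 0\<close>, and \<open>v z D = t z * v x D\<close> still holds.\<close>
  define t where "t z = v z D / v x D" for z
  have t: "v z D = t z * v x D" "\<bar>t z\<bar> \<le> 1" if "z \<in> X" for z
    using x(2)[OF that] unfolding t_def by (auto simp: divide_le_eq_1)
  obtain e where e: "\<And>j. j < D \<Longrightarrow> e j \<in> X"
    and IH: "\<And>z. z \<in> X \<Longrightarrow> \<exists>c. (\<forall>i<D. v z i - t z * v x i = (\<Sum>j<D. c j * (v (e j) i - t (e j) * v x i)))
              \<and> (\<Sum>j<D. \<bar>c j\<bar>) \<le> 2 ^ D - 1"
    using Suc[of "\<lambda>z i. v z i - t z * v x i"] by blast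
  have "\<exists>c. (\<forall>i<Suc D. v z i = (\<Sum>j<Suc D. c j * v ((e(D := x)) j) i)) \<and> (\<Sum>j<Suc D. \<bar>c j\<bar>) \<le> 2 ^ Suc D - 1"
    if z: "z \<in> X" for z
  proof -
    obtain c where c: "\<And>i. i < D \<Longrightarrow> v z i - t z * v x i = (\<Sum>j<D. c j * (v (e j) i - t (e j) * v x i))"
      "(\<Sum>j<D. \<bar>c j\<bar>) \<le> 2 ^ D - 1" using IH[OF z] by blast
    \<comment> \<open>Undoing the elimination collects all multiples of row \<open>x\<close>. As the
      factors \<open>t\<close> are at most 1 in absolute value, the coefficient sum at most doubles
      and grows by 1, which yields \<open>2 ^ D - 1\<close>.\<close>
    define m where "m = t z - (\<Sum>j<D. c j * t (e j))"
    have "v z i = (\<Sum>j<D. c j * v (e j) i) + m * v x i" if "i < Suc D" for i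
    proof (cases "i = D")
      case True
      have "(\<Sum>j<D. c j * v (e j) D) = (\<Sum>j<D. c j * t (e j)) * v x D"
        using e t(1) by (simp add: sum_distrib_right mult.assoc)
      then show ?thesis using t(1)[OF z] True unfolding m_def by (simp add: algebra_simps)
    next
      case False
      then have "v z i - t z * v x i = (\<Sum>j<D. c j * v (e j) i) - (\<Sum>j<D. c j * t (e j)) * v x i"
        using c(1)[of i] that by (simp add: algebra_simps sum_subtractf sum_distrib_left)
      then show ?thesis unfolding m_def by (simp add: algebra_simps)
    qed
    moreover have "\<bar>m\<bar> \<le> 1 + (\<Sum>j<D. \<bar>c j\<bar>)"
    proof -
      have "\<bar>\<Sum>j<D. c j * t (e j)\<bar> \<le> (\<Sum>j<D. \<bar>c j\<bar>)"
        by (rule order_trans[OF sum_abs], rule sum_mono)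
          (use e t(2) in \<open>auto simp: abs_mult intro: mult_left_le\<close>)
      then show ?thesis using t(2)[OF z] unfolding m_def by linarith
    qed
    ultimately show ?thesis
      using c(2) by (intro exI[of _ "c(D := m)"]) simp
  qed
  moreover have "(e(D := x)) j \<in> X" if "j < Suc D" for j using e x(1) that by auto
  ultimately show ?case by blast
qed

section \<open>Facets of polyhedra\<close>

abbreviation lookup_vec :: "rvec \<Rightarrow> nat \<Rightarrow> real" where
  "lookup_vec \<equiv> Poly_Mapping.lookup"

lemma lookup_scaleR [simp]: "lookup_vec (r *\<^sub>R x) i = r * lookup_vec x i"
proof -
  have "finite {i. r * lookup_vec x i \<noteq> 0}"
    by (rule finite_subset[OF _ finite_keys[of x]]) (auto simp: in_keys_iff)
  then show ?thesis unfolding scaleR_poly_mapping_def by simp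
qed

lemma Rn_iff: "x \<in> Rn n \<longleftrightarrow> (\<forall>i. i \<notin> {1..n} \<longrightarrow> lookup_vec x i = 0)"
  unfolding Rn_def by (auto simp: in_keys_iff subset_iff)

lemma subspace_Rn: "subspace (Rn n)"
  unfolding subspace_def by (auto simp: Rn_iff lookup_add)

lemma Rn_subset_span: "Rn n \<subseteq> span ((\<lambda>i. Poly_Mapping.single i 1) ` {1..n})"
proof
  fix x assume x: "x \<in> Rn n"
  have "x = (\<Sum>i\<in>{1..n}. lookup_vec x i *\<^sub>R Poly_Mapping.single i 1)"
    using x by (intro poly_mapping_eqI)
      (auto simp: lookup_sum lookup_single Rn_iff when_def sum.If_cases if_distrib cong: if_cong)
  also have "\<dots> \<in> span ((\<lambda>i. Poly_Mapping.single i 1) ` {1..n})"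
    by (intro span_sum span_scale span_base) auto
  finally show "x \<in> span ((\<lambda>i. Poly_Mapping.single i 1) ` {1..n})" .
qed

lemma linear_dot: "linear (dot n a)"
  unfolding linear_iff dot_def
  by (auto simp: lookup_add algebra_simps sum.distrib sum_distrib_left)

lemma dot_add: "dot n a (x + y) = dot n a x + dot n a y"
  and dot_diff: "dot n a (x - y) = dot n a x - dot n a y"
  and dot_scale: "dot n a (r *\<^sub>R x) = r * dot n a x"
  using linear_dot[of n a] by (simp_all add: linear_add linear_diff linear_cmul)

lemma dot_minus_left: "dot n (- a) x = - dot n a x"
  unfolding dot_def by (simp add: sum_negf)

text \<open>The ambient space is infinite-dimensional, and \<open>dim\<close> takes the default 0 on
  infinite-dimensional subspaces; the finite set \<open>W\<close> excludes this. A basis of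
  \<open>S\<close> extended to one of \<open>T\<close> must then grow.\<close>

lemma dim_strict_mono:
  fixes S T :: "'a::real_vector set"
  assumes S: "subspace S" and T: "subspace T" and "S \<subset> T" and W: "T \<subseteq> span W" "finite W"
  shows "dim S < dim T"
proof -
  obtain B where B: "B \<subseteq> S" "independent B" "S \<subseteq> span B" "card B = dim S"
    by (rule basis_exists)
  obtain C where C: "B \<subseteq> C" "C \<subseteq> T" "independent C" "T \<subseteq> span C"
    using maximal_independent_subset_extend[of B T] B \<open>S \<subset> T\<close> by blast
  have "finite C" using independent_span_bound[OF W(2) C(3)] C(2) W(1) by blast
  moreover have "B \<noteq> C"
    using B C \<open>S \<subset> T\<close> span_minimal[OF B(1) S] by auto
  ultimately have "card B < card C" using C(1) by (simp add: psubsetI psubset_card_mono)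
  moreover have "card C = dim T" using C by (intro basis_card_eq_dim) auto
  ultimately show ?thesis using B(4) by simp
qed

lemma dim_hyperplane:
  fixes L :: "'a::real_vector set"
  assumes L: "subspace L" and W: "L \<subseteq> span W" "finite W" and g: "linear g"
    and d: "d \<in> L" "g d \<noteq> (0::real)"
  shows "dim L = dim (L \<inter> {x. g x = 0}) + 1"
proof -
  define K where "K = L \<inter> {x. g x = 0}"
  have K: "subspace K" unfolding K_def
    using L g by (intro subspace_inter) (auto simp: subspace_def linear_add linear_cmul linear_0)
  obtain B where B: "B \<subseteq> K" "independent B" "K \<subseteq> span B" "card B = dim K"
    by (rule basis_exists)
  have "finite B" using independent_span_bound[OF W(2) B(2)] B(1) W(1) unfolding K_def by blast
  have "span B \<subseteq> K" using span_minimal[OF B(1) K] .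
  then have dB: "d \<notin> span B" using d(2) unfolding K_def by auto
  have "card (insert d B) = dim L"
  proof (rule basis_card_eq_dim)
    show "insert d B \<subseteq> L" using B(1) d(1) unfolding K_def by auto
    show "independent (insert d B)" using B(2) dB by (simp add: independent_insertI)
    show "L \<subseteq> span (insert d B)"
    proof
      fix x assume x: "x \<in> L"
      define r where "r = g x / g d"
      have "x - r *\<^sub>R d \<in> K" unfolding K_def r_def using x d L g
        by (simp add: subspace_diff subspace_scale linear_diff linear_cmul)
      then show "x \<in> span (insert d B)" using B(3) unfolding span_insert by auto
    qed
  qed
  moreover have "d \<notin> B" using dB span_base by blast
  ultimately show ?thesis using B(4) \<open>finite B\<close> unfolding K_def by simp
qed

text \<open>The midpoint of two points of \<open>F\<close> is strict in each inequality in which at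
  least one of them is, so strict points for single inequalities can be merged one at a
  time.\<close>

lemma common_strict_point:
  fixes a :: "'i \<Rightarrow> 'a::real_vector \<Rightarrow> real"
  assumes "finite J" "convex F" "F \<noteq> {}" "\<And>j. j \<in> J \<Longrightarrow> linear (a j)"
    and "\<And>j x. j \<in> J \<Longrightarrow> x \<in> F \<Longrightarrow> a j x \<le> b j"
    and "\<And>j. j \<in> J \<Longrightarrow> \<exists>x\<in>F. a j x < b j"
  shows "\<exists>p\<in>F. \<forall>j\<in>J. a j p < b j"
  using assms(1,4-)
proof (induction J rule: finite_induct)
  case empty
  then show ?case using \<open>F \<noteq> {}\<close> by auto
next
  case (insert k J)
  obtain p where p: "p \<in> F" "\<forall>j\<in>J. a j p < b j" using insert by auto
  obtain x where x: "x \<in> F" "a k x < b k" using insert.prems(3)[of k] by auto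
  define q where "q = (1/2) *\<^sub>R p + (1/2) *\<^sub>R x"
  have "q \<in> F" unfolding q_def using \<open>convex F\<close> p(1) x(1) by (intro convexD) auto
  moreover have "a j q = (a j p + a j x) / 2" if "j \<in> insert k J" for j
    unfolding q_def using insert.prems(1)[OF that] by (simp add: linear_add linear_cmul)
  moreover have "a j p \<le> b j" "a j x \<le> b j" if "j \<in> insert k J" for j
    using insert.prems(2)[OF that] p(1) x(1) by auto
  ultimately show ?case using p(2) x(2) by (intro bexI[of _ q]) fastforce+
qed

text \<open>Here \<open>\<alpha>\<close> holds the values at a point with strict slack and
  \<open>\<gamma>\<close> their rates of change along a direction: a short step in any direction
  stays feasible.\<close>

lemma common_small_step:
  fixes \<alpha> :: "'i \<Rightarrow> real"
  assumes "finite J" "\<And>j. j \<in> J \<Longrightarrow> \<alpha> j < \<beta> j"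
  shows "\<exists>e>0. \<forall>j\<in>J. \<alpha> j + e * \<gamma> j \<le> \<beta> j"
proof -
  have "\<forall>\<^sub>F e in at_right 0. \<forall>j\<in>J. \<alpha> j + e * \<gamma> j < \<beta> j"
  proof (intro eventually_ball_finite \<open>finite J\<close> ballI)
    fix j assume "j \<in> J"
    have "((\<lambda>e. \<alpha> j + e * \<gamma> j) \<longlongrightarrow> \<alpha> j + 0 * \<gamma> j) (at_right 0)"
      by (intro tendsto_intros)
    then show "\<forall>\<^sub>F e in at_right 0. \<alpha> j + e * \<gamma> j < \<beta> j"
      using assms(2)[OF \<open>j \<in> J\<close>] by (auto dest: order_tendstoD(2))
  qed
  moreover have "\<forall>\<^sub>F e::real in at_right 0. e > 0" by (simp add: eventually_at_right_less)
  ultimately have "\<forall>\<^sub>F e in at_right 0. e > 0 \<and> (\<forall>j\<in>J. \<alpha> j + e * \<gamma> j < \<beta> j)"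
    by (auto elim: eventually_elim2)
  from eventually_happens'[OF _ this] show ?thesis by (auto intro: less_imp_le)
qed

section \<open>Inequality systems and their faces\<close>

definition solutions :: "nat \<Rightarrow> (rvec \<times> real) set \<Rightarrow> rvec set" where
  "solutions m E = {x \<in> Rn m. \<forall>(a, b)\<in>E. dot m a x \<le> b}"

lemma convex_solutions: "convex (solutions m E)"
proof (rule convexI)
  fix x y and u v :: real
  assume xy: "x \<in> solutions m E" "y \<in> solutions m E" and uv: "0 \<le> u" "0 \<le> v" "u + v = 1"
  have "dot m a (u *\<^sub>R x + v *\<^sub>R y) \<le> b" if "(a, b) \<in> E" for a b
  proof -
    have "dot m a x \<le> b" "dot m a y \<le> b" using xy that unfolding solutions_def by auto
    then have "u * dot m a x + v * dot m a y \<le> u * b + v * b"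
      using uv by (intro add_mono mult_left_mono) auto
    also have "\<dots> = b" using uv(3) by (metis distrib_right mult_1)
    finally show ?thesis by (simp add: dot_add dot_scale)
  qed
  then show "u *\<^sub>R x + v *\<^sub>R y \<in> solutions m E"
    using xy subspace_Rn[of m] unfolding solutions_def
    by (auto simp: subspace_add subspace_scale)
qed

lemma polyhedron_inD:
  assumes "polyhedron_in m Q"
  shows "\<exists>E. finite E \<and> Q = solutions m E"
proof -
  obtain H where H: "finite H" "\<forall>h\<in>H. closed_halfspace_in m h" "Q = Rn m \<inter> \<Inter>H"
    using assms unfolding polyhedron_in_def by auto
  have "\<forall>h\<in>H. \<exists>ab. h = {x \<in> Rn m. dot m (fst ab) x \<le> snd ab}"
  proof
    fix h assume "h \<in> H"
    then obtain a b where "h = {x \<in> Rn m. dot m a x \<le> b}"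
      using H(2) unfolding closed_halfspace_in_def by blast
    then show "\<exists>ab. h = {x \<in> Rn m. dot m (fst ab) x \<le> snd ab}"
      by (intro exI[of _ "(a, b)"]) simp
  qed
  then obtain ab where ab: "\<And>h. h \<in> H \<Longrightarrow> h = {x \<in> Rn m. dot m (fst (ab h)) x \<le> snd (ab h)}"
    by metis
  have "Q = solutions m (ab ` H)"
    unfolding H(3) solutions_def using ab by (auto simp: case_prod_unfold)
  then show ?thesis using H(1) by blast
qed

text \<open>A pair with \<open>a = 0\<close> describes no halfspace, yet such pairs do occur, for
  instance from the empty set in \<open>base_ineqs\<close>. They are dropped: since one solution
  satisfies them, every point does.\<close>

lemma polyhedron_in_solutions:
  assumes "finite E" "E \<subseteq> Rn m \<times> UNIV" "solutions m E \<noteq> {}"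
  shows "polyhedron_in m (solutions m E)"
proof -
  define H where "H = (\<lambda>(a, b). {x \<in> Rn m. dot m a x \<le> b}) ` {e \<in> E. fst e \<noteq> 0}"
  have "finite H" unfolding H_def using assms(1) by simp
  moreover have "\<forall>h\<in>H. closed_halfspace_in m h"
    unfolding H_def closed_halfspace_in_def using assms(2) by (fastforce split: prod.splits)
  moreover have "solutions m E = Rn m \<inter> \<Inter>H"
  proof
    show "solutions m E \<subseteq> Rn m \<inter> \<Inter>H" unfolding solutions_def H_def by auto
    show "Rn m \<inter> \<Inter>H \<subseteq> solutions m E"
    proof
      fix x assume x: "x \<in> Rn m \<inter> \<Inter>H"
      obtain y where y: "y \<in> solutions m E" using assms(3) by auto
      have "dot m a x \<le> b" if ab: "(a, b) \<in> E" for a b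
      proof (cases "a = 0")
        case True
        then have "dot m a x = dot m a y" by (simp add: dot_def)
        then show ?thesis using y ab unfolding solutions_def by auto
      next
        case False
        then have "{x \<in> Rn m. dot m a x \<le> b} \<in> H" unfolding H_def using ab by force
        then show ?thesis using x by auto
      qed
      then show "x \<in> solutions m E" using x unfolding solutions_def by auto
    qed
  qed
  ultimately show ?thesis unfolding polyhedron_in_def by blast
qed

text \<open>The linear space parallel to the affine hull of a nonempty \<open>S\<close>.\<close>

definition directions :: "rvec set \<Rightarrow> rvec set" where
  "directions S = span {x - y |x y. x \<in> S \<and> y \<in> S}"

lemma affine_dimension_directions:
  "S \<noteq> {} \<Longrightarrow> affine_dimension S = int (dim (directions S))"
  unfolding affine_dimension_def directions_def by simp

lemma directionsI: "x \<in> S \<Longrightarrow> y \<in> S \<Longrightarrow> x - y \<in> directions S"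
  unfolding directions_def by (intro span_base) auto

lemma directions_subset:
  assumes "subspace U" "\<And>x y. x \<in> S \<Longrightarrow> y \<in> S \<Longrightarrow> x - y \<in> U"
  shows "directions S \<subseteq> U"
  unfolding directions_def by (rule span_minimal) (use assms in auto)

lemma subspace_directions: "subspace (directions S)"
  unfolding directions_def by simp

lemma directions_subset_Rn: "S \<subseteq> Rn m \<Longrightarrow> directions S \<subseteq> Rn m"
  using subspace_Rn[of m] by (intro directions_subset) (auto simp: subspace_diff subset_iff)

lemma subspace_dot_zero: "subspace {x. dot m a x = 0}"
  using linear_dot[of m a] by (auto simp: subspace_def linear_add linear_cmul linear_0)

text \<open>Suppose every inequality tight on \<open>F\<close> is tight on the whole polyhedron.
  Then \<open>F\<close> has a point \<open>p\<close> strict in all remaining ones, and the segment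
  from any \<open>q\<close> to \<open>p\<close> can be prolonged beyond \<open>p\<close>. The face
  property at \<open>p\<close> puts \<open>q\<close> into \<open>F\<close>, so \<open>F\<close> is
  not proper.\<close>

lemma proper_face_in_hyperplane:
  assumes E: "finite E" and F: "F face_of solutions m E" "F \<noteq> {}" "F \<noteq> solutions m E"
  shows "\<exists>(a, b)\<in>E. (\<forall>x\<in>F. dot m a x = b) \<and> (\<exists>x\<in>solutions m E. dot m a x \<noteq> b)"
proof (rule ccontr)
  let ?Q = "solutions m E"
  assume neg: "\<not> ?thesis"
  define J where "J = {(a, b) \<in> E. \<exists>x\<in>?Q. dot m a x \<noteq> b}"
  have FQ: "F \<subseteq> ?Q" using F(1) unfolding face_of_def by auto
  have "\<exists>p\<in>F. \<forall>j\<in>J. dot m (fst j) p < snd j"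
  proof (rule common_strict_point)
    show "finite J" unfolding J_def by (rule finite_subset[OF _ E]) auto
    show "convex F" using F(1) unfolding face_of_def by auto
    show le: "dot m (fst j) x \<le> snd j" if "j \<in> J" "x \<in> F" for j x
    proof -
      have "x \<in> ?Q" using that FQ by auto
      then show ?thesis using that(1) unfolding J_def solutions_def by auto
    qed
    show "\<exists>x\<in>F. dot m (fst j) x < snd j" if j: "j \<in> J" for j
    proof -
      have "\<exists>x\<in>F. dot m (fst j) x \<noteq> snd j" using neg j unfolding J_def by fastforce
      then show ?thesis using le[OF j] by (meson less_le)
    qed
  qed (use F(2) linear_dot in auto)
  then obtain p where pF: "p \<in> F" and "\<forall>j\<in>J. dot m (fst j) p < snd j" by blast
  then have "dot m a p < b" if "(a, b) \<in> J" for a b using that by force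
  note p = pF this
  have "q \<in> F" if q: "q \<in> ?Q" for q
  proof (cases "p = q")
    case True
    then show ?thesis using p by auto
  next
    case False
    have "\<exists>e>0. \<forall>j\<in>J. dot m (fst j) p + e * dot m (fst j) (p - q) \<le> snd j"
    proof (rule common_small_step)
      show "finite J" unfolding J_def by (rule finite_subset[OF _ E]) auto
    qed (use p(2) in auto)
    then obtain e where e: "e > 0" "\<And>a b. (a, b) \<in> J \<Longrightarrow> dot m a p + e * dot m a (p - q) \<le> b"
      by fastforce
    define q' where "q' = p + e *\<^sub>R (p - q)"
    have "q' \<in> ?Q"
    proof -
      have "q' \<in> Rn m" unfolding q'_def
        using p(1) FQ q subspace_Rn[of m] unfolding solutions_def
        by (auto intro!: subspace_add subspace_scale subspace_diff)
      moreover have "dot m a q' \<le> b" if ab: "(a, b) \<in> E" for a b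
      proof (cases "(a, b) \<in> J")
        case True
        then show ?thesis using e(2) unfolding q'_def by (simp add: dot_add dot_scale)
      next
        case False
        then have "dot m a p = b" "dot m a q = b" using ab q p(1) FQ unfolding J_def by auto
        then show ?thesis unfolding q'_def by (simp add: dot_add dot_scale dot_diff)
      qed
      ultimately show ?thesis unfolding solutions_def by auto
    qed
    moreover have "p \<in> open_segment q q'"
    proof -
      \<comment> \<open>Solves \<open>p = (1 - u) *\<^sub>R q + u *\<^sub>R q'\<close> for
        \<open>q' = p + e *\<^sub>R (p - q)\<close>.\<close>
      define u where "u = 1 / (1 + e)"
      have "0 < u" "u < 1" "u * (1 + e) = 1" using e(1) unfolding u_def by auto
      moreover have "(1 - u) *\<^sub>R q + u *\<^sub>R q' = (1 - u * (1 + e)) *\<^sub>R q + (u * (1 + e)) *\<^sub>R p"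
        unfolding q'_def by (simp add: algebra_simps)
      moreover have "q \<noteq> q'"
      proof
        assume "q = q'"
        then have "(1 + e) *\<^sub>R (p - q) = 0" unfolding q'_def by (simp add: algebra_simps)
        then show False using e(1) False by auto
      qed
      ultimately show ?thesis unfolding in_segment by (intro conjI exI[of _ u]) auto
    qed
    ultimately show ?thesis using F(1) q p(1) unfolding face_of_def by blast
  qed
  then show False using FQ F(3) by auto
qed

lemma face_dimension_less:
  assumes E: "finite E" and F: "F face_of solutions m E" "F \<noteq> {}" "F \<noteq> solutions m E"
  shows "affine_dimension F < affine_dimension (solutions m E)"
proof -
  let ?Q = "solutions m E"
  have FQ: "F \<subseteq> ?Q" using F(1) unfolding face_of_def by auto
  have QR: "?Q \<subseteq> Rn m" unfolding solutions_def by auto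
  obtain a b z where ab: "\<forall>x\<in>F. dot m a x = b" and z: "z \<in> ?Q" "dot m a z \<noteq> b"
    using proper_face_in_hyperplane[OF assms] by blast
  obtain y where y: "y \<in> F" using F(2) by auto
  have "directions F \<subseteq> {x. dot m a x = 0}"
    using ab by (intro directions_subset subspace_dot_zero) (auto simp: dot_diff)
  moreover have "directions F \<subseteq> directions ?Q"
    using FQ by (intro directions_subset subspace_directions directionsI) auto
  moreover have "z - y \<in> directions ?Q" using z y FQ by (auto intro: directionsI)
  moreover have "dot m a (z - y) \<noteq> 0" using z y ab by (simp add: dot_diff)
  ultimately have "directions F \<subset> directions ?Q" by blast
  then have "dim (directions F) < dim (directions ?Q)"
    by (rule dim_strict_mono[OF subspace_directions subspace_directions])
      (use directions_subset_Rn[OF QR] Rn_subset_span in blast)+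
  then show ?thesis using F(2) FQ by (subst (1 2) affine_dimension_directions) auto
qed

lemma exposed_face:
  assumes "(a, b) \<in> E"
  shows "solutions m E \<inter> {x. dot m a x = b} face_of solutions m E"
proof -
  have le: "dot m a x \<le> b" if "x \<in> solutions m E" for x
    using that assms unfolding solutions_def by auto
  have "convex {x. dot m a x = b}"
    by (auto simp: convex_def dot_add dot_scale simp flip: distrib_right)
  moreover have "dot m a x = b \<and> dot m a y = b"
    if x: "x \<in> solutions m E" and y: "y \<in> solutions m E" and z: "dot m a z = b"
      and seg: "z \<in> open_segment x y" for x y z
  proof -
    obtain u where u: "0 < u" "u < 1" "z = (1 - u) *\<^sub>R x + u *\<^sub>R y"
      using seg unfolding in_segment by auto
    have "(1 - u) * (b - dot m a x) + u * (b - dot m a y) = 0"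
      using z unfolding u(3) by (simp add: dot_add dot_scale dot_diff algebra_simps)
    moreover have "(1 - u) * (b - dot m a x) \<ge> 0" "u * (b - dot m a y) \<ge> 0"
      using u le[OF x] le[OF y] by auto
    ultimately have "(1 - u) * (b - dot m a x) = 0" "u * (b - dot m a y) = 0" by linarith+
    then show ?thesis using u by auto
  qed
  ultimately show ?thesis
    unfolding face_of_def by (intro conjI ballI impI convex_Int convex_solutions IntI) blast+
qed

text \<open>A proper face lies in the hyperplane of some inequality, hence in an exposed proper face
  \<open>G\<close>. Adding the reversed inequality shows \<open>G\<close> to be a solution set
  again, so \<open>F \<noteq> G\<close> would make the dimension drop twice.\<close>

lemma facet_is_exposed:
  assumes E: "finite E" and F: "is_facet_of F (solutions m E)"
  shows "\<exists>(a, b)\<in>E. F = solutions m E \<inter> {x. dot m a x = b}"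
proof -
  let ?Q = "solutions m E"
  have Ff: "F face_of ?Q" "F \<noteq> {}" "affine_dimension F = affine_dimension ?Q - 1"
    using F unfolding is_facet_of_def by auto
  then have "F \<noteq> ?Q" by auto
  then obtain a b z where ab: "(a, b) \<in> E" "\<forall>x\<in>F. dot m a x = b"
    and z: "z \<in> ?Q" "dot m a z \<noteq> b"
    using proper_face_in_hyperplane[OF E Ff(1,2)] by blast
  define G where "G = ?Q \<inter> {x. dot m a x = b}"
  have G: "G = solutions m (insert (- a, - b) E)"
    using ab(1) unfolding G_def solutions_def by (auto simp: dot_minus_left intro: antisym)
  have FG: "F \<subseteq> G" using Ff(1) ab(2) unfolding G_def face_of_def by auto
  have Gf: "G face_of ?Q" unfolding G_def by (rule exposed_face[OF ab(1)])
  have "affine_dimension G < affine_dimension ?Q"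
    using z FG Ff(2) by (intro face_dimension_less[OF E Gf]) (auto simp: G_def)
  moreover have "affine_dimension F < affine_dimension G" if "F \<noteq> G"
    unfolding G
  proof (rule face_dimension_less)
    show "F face_of solutions m (insert (- a, - b) E)"
      unfolding G[symmetric] using Ff(1) FG Gf unfolding face_of_def by blast
  qed (use E Ff(2) that G in auto)
  ultimately have "F = G" using Ff(3) by linarith
  then show ?thesis using ab(1) unfolding G_def by blast
qed

lemma facets_subset:
  assumes "finite E"
  shows "{F. is_facet_of F (solutions m E)} \<subseteq> (\<lambda>(a, b). solutions m E \<inter> {x. dot m a x = b}) ` E"
  using facet_is_exposed[OF assms] by fastforce

lemma num_facets_le: "finite E \<Longrightarrow> num_facets (solutions m E) \<le> card E"
  unfolding num_facets_def using facets_subset[of E m]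
  by (meson card_image_le card_mono finite_imageI order_trans)

text \<open>Without \<open>(a, b)\<close> some point \<open>z\<close> of the affine hull violates
  only this inequality of \<open>I\<close>. The segment to \<open>z\<close> from a point
  \<open>q\<close> strict in all of \<open>I\<close> meets the hyperplane at a point
  \<open>w\<close> that is still strict in the others. Around \<open>w\<close> the face fills the
  hyperplane within the affine hull, which gives codimension one; that \<open>w\<close> lies on no
  other hyperplane later tells facets apart.\<close>

lemma irredundant_facet:
  assumes I: "finite I" and p: "p \<in> Q" and QR: "Q \<subseteq> Rn m" and QE: "Q = solutions m E" "I \<subseteq> E"
    and Q: "Q = {x. x - p \<in> directions Q \<and> (\<forall>(a, b)\<in>I. dot m a x \<le> b)}"
    and irr: "\<And>e. e \<in> I \<Longrightarrow>
      Q \<noteq> {x. x - p \<in> directions Q \<and> (\<forall>(a, b)\<in>I - {e}. dot m a x \<le> b)}"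
    and ab: "(a, b) \<in> I"
  shows "is_facet_of (Q \<inter> {x. dot m a x = b}) Q"
    and "\<exists>w\<in>Q. dot m a w = b \<and> (\<forall>(a', b')\<in>I - {(a, b)}. dot m a' w < b')"
proof -
  let ?L = "directions Q"
  have sL: "subspace ?L" by (rule subspace_directions)
  have QI: "x \<in> Q" if "x - p \<in> ?L" "\<And>a b. (a, b) \<in> I \<Longrightarrow> dot m a x \<le> b" for x
  proof -
    have "x \<in> {x. x - p \<in> directions Q \<and> (\<forall>(a, b)\<in>I. dot m a x \<le> b)}" using that by auto
    then show ?thesis using Q by argo
  qed
  have Q_dir: "x - p \<in> ?L" if "x \<in> Q" for x using that p by (rule directionsI)
  have Q_le: "dot m a x \<le> b" if "x \<in> Q" "(a, b) \<in> I" for x a b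
    using that QE unfolding solutions_def by auto
  have violated: "\<exists>z. z - p \<in> ?L \<and> (\<forall>(a, b)\<in>I - {e}. dot m a z \<le> b) \<and> dot m (fst e) z > snd e"
    if e: "e \<in> I" for e
  proof -
    let ?Q' = "{x. x - p \<in> ?L \<and> (\<forall>(a, b)\<in>I - {e}. dot m a x \<le> b)}"
    have "Q \<subseteq> ?Q'" using Q_le Q_dir by auto
    then obtain z where z: "z \<in> ?Q'" "z \<notin> Q" using irr[OF e] by blast
    then have "\<not> dot m (fst e) z \<le> snd e"
      using QI[of z] by fastforce
    then show ?thesis using z by auto
  qed
  have "\<exists>q\<in>Q. \<forall>j\<in>I. dot m (fst j) q < snd j"
  proof (rule common_strict_point)
    show "convex Q" unfolding QE(1) by (rule convex_solutions)
    show le: "dot m (fst j) x \<le> snd j" if "j \<in> I" "x \<in> Q" for j x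
      using Q_le[of x "fst j" "snd j"] that by simp
    show "\<exists>x\<in>Q. dot m (fst j) x < snd j" if j: "j \<in> I" for j
    proof (rule ccontr)
      assume "\<not> ?thesis"
      \<comment> \<open>An inequality tight on all of \<open>Q\<close> is constant on the affine
        hull, so no point of the hull could violate it.\<close>
      then have eq: "dot m (fst j) x = snd j" if "x \<in> Q" for x
        using le[OF j that] that by force
      then have "?L \<subseteq> {x. dot m (fst j) x = 0}"
        by (intro directions_subset subspace_dot_zero) (auto simp: dot_diff)
      moreover obtain z where z: "z - p \<in> ?L" "dot m (fst j) z > snd j"
        using violated[OF j] by auto
      ultimately have "dot m (fst j) (z - p) = 0" by auto
      then show False using z(2) eq[OF p] by (simp add: dot_diff)
    qed
  qed (use I p linear_dot in auto)
  then obtain q where q: "q \<in> Q" and "\<forall>j\<in>I. dot m (fst j) q < snd j" by blast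
  then have qlt: "dot m a q < b" if "(a, b) \<in> I" for a b using that by force
  obtain z where z: "z - p \<in> ?L" "\<And>a' b'. (a', b') \<in> I - {(a, b)} \<Longrightarrow> dot m a' z \<le> b'" "dot m a z > b"
    using violated[OF ab] by auto
  define t where "t = (b - dot m a q) / (dot m a z - dot m a q)"
  have t: "0 < t" "t < 1" "t * (dot m a z - dot m a q) = b - dot m a q"
    using qlt[OF ab] z(3) unfolding t_def by auto
  define w where "w = q + t *\<^sub>R (z - q)"
  have qL: "q - p \<in> ?L" using q p by (rule directionsI)
  have zq: "z - q \<in> ?L" using subspace_diff[OF sL z(1) qL] by simp
  have wL: "w - p \<in> ?L"
    using subspace_add[OF sL qL subspace_scale[OF sL zq, of t]] unfolding w_def
    by (simp add: algebra_simps)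
  have wab: "dot m a w = b" unfolding w_def using t(3) by (simp add: dot_add dot_scale dot_diff)
  have wlt: "dot m a' w < b'" if ab': "(a', b') \<in> I - {(a, b)}" for a' b'
  proof -
    have "dot m a' w = (1 - t) * dot m a' q + t * dot m a' z"
      unfolding w_def by (simp add: dot_add dot_scale dot_diff algebra_simps)
    also have "\<dots> < (1 - t) * b' + t * b'"
      using t qlt[of a' b'] z(2)[OF ab'] ab' by (intro add_less_le_mono) auto
    finally show ?thesis by (simp add: algebra_simps)
  qed
  have wQ: "w \<in> Q"
  proof (rule QI[OF wL])
    show "dot m a' w \<le> b'" if "(a', b') \<in> I" for a' b'
      using wab wlt[of a' b'] that by (cases "(a', b') = (a, b)") auto
  qed
  then show "\<exists>w\<in>Q. dot m a w = b \<and> (\<forall>(a', b')\<in>I - {(a, b)}. dot m a' w < b')"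
    using wab wlt by blast
  define F where "F = Q \<inter> {x. dot m a x = b}"
  have wF: "w \<in> F" unfolding F_def using wQ wab by auto
  have "directions F = ?L \<inter> {x. dot m a x = 0}"
  proof
    show "directions F \<subseteq> ?L \<inter> {x. dot m a x = 0}"
      using sL by (intro directions_subset subspace_inter subspace_dot_zero)
        (auto simp: F_def dot_diff intro: directionsI)
    show "?L \<inter> {x. dot m a x = 0} \<subseteq> directions F"
    proof
      fix d assume d: "d \<in> ?L \<inter> {x. dot m a x = 0}"
      have "\<exists>e>0. \<forall>j\<in>I - {(a, b)}. dot m (fst j) w + e * dot m (fst j) d \<le> snd j"
      proof (rule common_small_step)
        show "dot m (fst j) w < snd j" if "j \<in> I - {(a, b)}" for j
          using wlt[of "fst j" "snd j"] that by simp
      qed (use I in auto)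
      then obtain e where e: "e > 0" "\<forall>j\<in>I - {(a, b)}. dot m (fst j) w + e * dot m (fst j) d \<le> snd j"
        by blast
      have "w + e *\<^sub>R d - p \<in> ?L"
        using subspace_add[OF sL wL subspace_scale[OF sL, of d e]] d by (simp add: algebra_simps)
      moreover have "dot m a (w + e *\<^sub>R d) = b" using wab d by (simp add: dot_add dot_scale)
      moreover have "dot m a' (w + e *\<^sub>R d) \<le> b'" if "(a', b') \<in> I" for a' b'
        using bspec[OF e(2), of "(a', b')"] that \<open>dot m a (w + e *\<^sub>R d) = b\<close>
        by (cases "(a', b') = (a, b)") (simp_all add: dot_add dot_scale)
      ultimately have "w + e *\<^sub>R d \<in> F" unfolding F_def by (auto intro: QI)
      then have "e *\<^sub>R d \<in> directions F" using directionsI[OF _ wF] by fastforce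
      then have "(1/e) *\<^sub>R (e *\<^sub>R d) \<in> directions F"
        using subspace_directions subspace_scale by blast
      then show "d \<in> directions F" using e(1) by simp
    qed
  qed
  moreover have "dim ?L = dim (?L \<inter> {x. dot m a x = 0}) + 1"
  proof (rule dim_hyperplane[OF sL _ _ linear_dot zq])
    show "?L \<subseteq> span ((\<lambda>i. Poly_Mapping.single i 1) ` {1..m})"
      using directions_subset_Rn[OF QR] Rn_subset_span by blast
    show "dot m a (z - q) \<noteq> 0" using qlt[OF ab] z(3) by (simp add: dot_diff)
  qed simp
  ultimately have "affine_dimension F = affine_dimension Q - 1"
    using wF p by (subst (1 2) affine_dimension_directions) auto
  moreover have "F face_of Q"
    unfolding F_def QE(1) by (rule exposed_face) (use ab QE(2) in auto)
  ultimately show "is_facet_of (Q \<inter> {x. dot m a x = b}) Q"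
    unfolding is_facet_of_def F_def[symmetric] using wF by auto
qed

text \<open>Equations of the affine hull are absorbed into \<open>directions Q\<close>. A subsystem
  of minimum size that still describes \<open>Q\<close> inside its hull is irredundant, so its
  members cut out distinct facets.\<close>

lemma polyhedron_facet_description:
  assumes "polyhedron_in m Q" and p: "p \<in> Q"
  shows "\<exists>I. finite I \<and> card I \<le> num_facets Q \<and>
    Q = {x. x - p \<in> directions Q \<and> (\<forall>(a, b)\<in>I. dot m a x \<le> b)}"
proof -
  obtain E where E: "finite E" "Q = solutions m E" using polyhedron_inD[OF assms(1)] by blast
  have QR: "Q \<subseteq> Rn m" unfolding E(2) solutions_def by auto
  define D where "D I = {x. x - p \<in> directions Q \<and> (\<forall>(a, b)\<in>I. dot m a x \<le> b)}" for I
  have "Q = D E"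
  proof
    show "Q \<subseteq> D E" using directionsI[OF _ p] unfolding D_def E(2) solutions_def by auto
    have "x \<in> Rn m" if "x - p \<in> directions Q" for x
    proof -
      have "x - p \<in> Rn m" using that directions_subset_Rn[OF QR] by auto
      then show ?thesis using subspace_add[OF subspace_Rn, of "x - p" m p] p QR by auto
    qed
    then show "D E \<subseteq> Q" using E(2) unfolding D_def solutions_def by auto
  qed
  then obtain I where I: "I \<subseteq> E" "Q = D I"
    and min: "\<And>I'. I' \<subseteq> E \<Longrightarrow> Q = D I' \<Longrightarrow> card I \<le> card I'"
    using exists_least_iff[of "\<lambda>k. \<exists>I\<subseteq>E. Q = D I \<and> card I = k"]
    by (metis (no_types, lifting) leI order_refl)
  have fI: "finite I" using I(1) E(1) finite_subset by auto
  have irr: "Q \<noteq> D (I - {e})" if "e \<in> I" for e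
    using min[of "I - {e}"] that I(1) fI by (metis card_Diff1_less Diff_subset not_le order_trans)
  note facet = irredundant_facet[OF fI p QR E(2) I(1) I(2)[unfolded D_def] irr[unfolded D_def]]
  define h where "h = (\<lambda>(a, b). Q \<inter> {x. dot m a x = b})"
  have "card I = card (h ` I)"
  proof (intro card_image[symmetric] inj_onI)
    fix i j assume i: "i \<in> I" and j: "j \<in> I" and eq: "h i = h j"
    show "i = j"
    proof (rule ccontr)
      assume "i \<noteq> j"
      obtain w where w: "w \<in> Q" "dot m (fst i) w = snd i"
        "\<forall>(a', b')\<in>I - {i}. dot m a' w < b'"
        using facet(2)[of "fst i" "snd i"] i by auto
      then have "w \<in> h j" using eq[symmetric] unfolding h_def by (auto simp: case_prod_unfold)
      moreover have "dot m (fst j) w < snd j" using w(3) j \<open>i \<noteq> j\<close> by (auto simp: case_prod_unfold)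
      ultimately show False unfolding h_def by (auto simp: case_prod_unfold)
    qed
  qed
  also have "\<dots> \<le> num_facets Q"
    unfolding num_facets_def
  proof (rule card_mono)
    show "finite {F. is_facet_of F Q}"
      unfolding E(2) using facets_subset[OF E(1)] E(1) by (metis finite_imageI finite_subset)
    show "h ` I \<subseteq> {F. is_facet_of F Q}" unfolding h_def using facet(1) by auto
  qed
  finally show ?thesis using fI I(2) unfolding D_def by blast
qed

section \<open>Base polytopes and the permutahedron\<close>

lemma lookup_sum_single:
  "finite A \<Longrightarrow> lookup_vec (\<Sum>i\<in>A. Poly_Mapping.single i (c i)) j = (if j \<in> A then c j else 0)"
  by (simp add: lookup_sum lookup_single when_def)

definition charvec :: "nat set \<Rightarrow> rvec" where
  "charvec T = (\<Sum>i\<in>T. Poly_Mapping.single i 1)"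

lemma lookup_charvec: "finite T \<Longrightarrow> lookup_vec (charvec T) i = (if i \<in> T then 1 else 0)"
  unfolding charvec_def by (simp add: lookup_sum_single)

lemma dot_charvec:
  assumes "T \<subseteq> {1..n}"
  shows "dot n (charvec T) x = (\<Sum>i\<in>T. lookup_vec x i)"
proof -
  have "finite T" using assms finite_subset by auto
  then have "dot n (charvec T) x = (\<Sum>i\<in>{1..n}. if i \<in> T then lookup_vec x i else 0)"
    unfolding dot_def by (intro sum.cong) (auto simp: lookup_charvec)
  also have "\<dots> = (\<Sum>i\<in>T. lookup_vec x i)"
    using assms by (simp add: sum.If_cases Int_absorb1)
  finally show ?thesis .
qed

lemma charvec_in_Rn: "T \<subseteq> {1..n} \<Longrightarrow> charvec T \<in> Rn n"
  using finite_subset[of T "{1..n}"] by (auto simp: Rn_iff lookup_charvec)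

definition base_polytope :: "nat \<Rightarrow> (nat set \<Rightarrow> real) \<Rightarrow> rvec set" where
  "base_polytope n f = {x \<in> Rn n. (\<forall>T\<subseteq>{1..n}. (\<Sum>i\<in>T. lookup_vec x i) \<le> f T) \<and>
     (\<Sum>i\<in>{1..n}. lookup_vec x i) = f {1..n}}"

definition base_ineqs :: "nat \<Rightarrow> (nat set \<Rightarrow> real) \<Rightarrow> (rvec \<times> real) set" where
  "base_ineqs n f = insert (- charvec {1..n}, - f {1..n}) ((\<lambda>T. (charvec T, f T)) ` Pow {1..n})"

lemma base_polytope_eq_solutions: "base_polytope n f = solutions n (base_ineqs n f)"
  unfolding base_polytope_def base_ineqs_def solutions_def
  by (auto simp: dot_charvec dot_minus_left intro: antisym)

lemma norm_rvec: "norm (x::rvec) = (\<Sum>i\<in>Poly_Mapping.keys x. \<bar>lookup_vec x i\<bar>)"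
  by (simp add: norm_poly_mapping_def dist_poly_mapping_def)

text \<open>With the total fixed, the upper bound on the complement of \<open>T\<close> is a lower
  bound on \<open>T\<close>. The estimate is uniform in \<open>x\<close>; it serves for boundedness
  and later as the size limit \<open>C\<close> of the multipliers.\<close>

lemma base_polytope_slack_le:
  assumes "x \<in> base_polytope n f" "T \<subseteq> {1..n}"
  shows "f T - (\<Sum>i\<in>T. lookup_vec x i) \<le> f T + f ({1..n} - T) - f {1..n}"
proof -
  have "(\<Sum>i\<in>{1..n}. lookup_vec x i) = (\<Sum>i\<in>T. lookup_vec x i) + (\<Sum>i\<in>{1..n} - T. lookup_vec x i)"
    using assms(2) by (metis add.commute finite_atLeastAtMost sum.subset_diff)
  moreover have "(\<Sum>i\<in>{1..n} - T. lookup_vec x i) \<le> f ({1..n} - T)"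
    using assms unfolding base_polytope_def by blast
  moreover have "(\<Sum>i\<in>{1..n}. lookup_vec x i) = f {1..n}"
    using assms(1) unfolding base_polytope_def by blast
  ultimately show ?thesis by linarith
qed

lemma bounded_base_polytope: "bounded (base_polytope n f)"
proof -
  define B where "B = (\<Sum>T\<in>Pow {1..n}. \<bar>f T\<bar>)"
  have fB: "\<bar>f T\<bar> \<le> B" if "T \<subseteq> {1..n}" for T
    unfolding B_def using that by (intro member_le_sum) auto
  have coord: "\<bar>lookup_vec x i\<bar> \<le> 2 * B" if x: "x \<in> base_polytope n f" and i: "i \<in> {1..n}" for x i
  proof -
    have "(\<Sum>j\<in>{i}. lookup_vec x j) \<le> f {i}" using x i unfolding base_polytope_def by blast
    moreover have "f {i} - (\<Sum>j\<in>{i}. lookup_vec x j) \<le> f {i} + f ({1..n} - {i}) - f {1..n}"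
      by (rule base_polytope_slack_le[OF x]) (use i in auto)
    ultimately show ?thesis
      using fB[of "{i}"] fB[of "{1..n} - {i}"] fB[of "{1..n}"] i by (auto simp: abs_le_iff)
  qed
  have "norm x \<le> (\<Sum>i\<in>{1..n}. 2 * B)" if x: "x \<in> base_polytope n f" for x
  proof -
    have "Poly_Mapping.keys x \<subseteq> {1..n}" using x unfolding base_polytope_def Rn_def by auto
    then have "norm x \<le> (\<Sum>i\<in>{1..n}. \<bar>lookup_vec x i\<bar>)"
      unfolding norm_rvec by (intro sum_mono2) auto
    also have "\<dots> \<le> (\<Sum>i\<in>{1..n}. 2 * B)" by (rule sum_mono) (use coord[OF x] in auto)
    finally show ?thesis .
  qed
  then show ?thesis unfolding bounded_iff by blast
qed

lemma polytope_in_base_polytope: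
  assumes "base_polytope n f \<noteq> {}"
  shows "polytope_in n (base_polytope n f)"
proof -
  have "base_ineqs n f \<subseteq> Rn n \<times> UNIV" unfolding base_ineqs_def
    using charvec_in_Rn subspace_neg[OF subspace_Rn] by auto
  then have "polyhedron_in n (base_polytope n f)"
    using assms unfolding base_polytope_eq_solutions
    by (intro polyhedron_in_solutions) (auto simp: base_ineqs_def)
  then show ?thesis unfolding polytope_in_def using bounded_base_polytope by blast
qed

section \<open>Submodular functions and greedy vertices\<close>

definition submodular :: "nat \<Rightarrow> (nat set \<Rightarrow> real) \<Rightarrow> bool" where
  "submodular n f \<longleftrightarrow> f {} = 0 \<and>
     (\<forall>S T. S \<subseteq> {1..n} \<longrightarrow> T \<subseteq> {1..n} \<longrightarrow> f (S \<union> T) + f (S \<inter> T) \<le> f S + f T)"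

text \<open>Edmonds' greedy vector: elements are added in order of decreasing
  \<open>\<sigma>\<close>, and each coordinate is the marginal gain of its element.\<close>

definition greedy :: "nat \<Rightarrow> (nat set \<Rightarrow> real) \<Rightarrow> (nat \<Rightarrow> nat) \<Rightarrow> rvec" where
  "greedy n f \<sigma> = (\<Sum>i\<in>{1..n}. Poly_Mapping.single i
     (f {l \<in> {1..n}. \<sigma> i \<le> \<sigma> l} - f {l \<in> {1..n}. \<sigma> i < \<sigma> l}))"

text \<open>\<open>W j\<close> collects the \<open>j\<close> elements with largest
  \<open>\<sigma>\<close>-values. By submodularity the marginal gain at the full prefix
  \<open>W j\<close> is at most that at \<open>T \<inter> W j\<close>, which gives the inequality;
  if \<open>T\<close> is closed upwards under \<open>\<sigma>\<close>, its traces are prefixes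
  themselves and the gains telescope.\<close>

lemma greedy_prefix:
  assumes f: "submodular n f" and \<sigma>: "\<sigma> permutes {1..n}" and T: "T \<subseteq> {1..n}" and "j \<le> n"
  defines "W \<equiv> \<lambda>j. {l \<in> {1..n}. n - j < \<sigma> l}"
  shows "(\<Sum>i\<in>T \<inter> W j. lookup_vec (greedy n f \<sigma>) i) \<le> f (T \<inter> W j) \<and>
    ((\<forall>i\<in>T. \<forall>l\<in>{1..n}. \<sigma> i < \<sigma> l \<longrightarrow> l \<in> T) \<longrightarrow>
      (\<Sum>i\<in>T \<inter> W j. lookup_vec (greedy n f \<sigma>) i) = f (T \<inter> W j))"
  using \<open>j \<le> n\<close>
proof (induction j)
  case 0
  have "\<sigma> l \<le> n" if "l \<in> {1..n}" for l
    using permutes_in_image[OF \<sigma>, of l] that by auto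
  then have "W 0 = {}" unfolding W_def by (auto simp: not_less)
  then show ?case using f unfolding submodular_def by simp
next
  case (Suc j)
  \<comment> \<open>The only element that \<open>W (Suc j)\<close> has in addition to
    \<open>W j\<close>.\<close>
  define e where "e = inv \<sigma> (n - j)"
  have se: "\<sigma> e = n - j" unfolding e_def using permutes_inverses[OF \<sigma>] by simp
  have "\<sigma> e \<in> {1..n}" using se Suc.prems by auto
  then have e: "e \<in> {1..n}" using permutes_in_image[OF \<sigma>] by blast
  have inj: "\<sigma> l = \<sigma> e \<Longrightarrow> l = e" for l using permutes_inj[OF \<sigma>] by (auto dest: injD)
  have W: "{l \<in> {1..n}. \<sigma> e < \<sigma> l} = W j" unfolding W_def se by auto
  have W': "{l \<in> {1..n}. \<sigma> e \<le> \<sigma> l} = W (Suc j)"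
    unfolding W_def se using Suc.prems by auto
  have WS: "W (Suc j) = insert e (W j)"
    unfolding W[symmetric] W'[symmetric] using e inj by (auto simp: le_less)
  have eW: "e \<notin> W j" unfolding W_def using se by auto
  have sub: "W j \<subseteq> {1..n}" "W (Suc j) \<subseteq> {1..n}" unfolding W_def by auto
  have ge: "lookup_vec (greedy n f \<sigma>) e = f (W (Suc j)) - f (W j)"
    unfolding greedy_def using e by (simp only: lookup_sum_single finite_atLeastAtMost W W' if_True)
  show ?case
  proof (cases "e \<in> T")
    case False
    then have "T \<inter> W (Suc j) = T \<inter> W j" using WS by auto
    then show ?thesis using Suc by auto
  next
    case True
    have TW: "T \<inter> W (Suc j) = insert e (T \<inter> W j)" using WS True by auto
    have fin: "finite (T \<inter> W j)" using sub(1) by (meson finite_Int finite_subset finite_atLeastAtMost)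
    have sum: "(\<Sum>i\<in>T \<inter> W (Suc j). lookup_vec (greedy n f \<sigma>) i) =
        f (W (Suc j)) - f (W j) + (\<Sum>i\<in>T \<inter> W j. lookup_vec (greedy n f \<sigma>) i)"
      unfolding TW using fin eW ge by simp
    have "(T \<inter> W (Suc j)) \<union> W j = W (Suc j)" "(T \<inter> W (Suc j)) \<inter> W j = T \<inter> W j"
      using WS True by auto
    then have "f (W (Suc j)) + f (T \<inter> W j) \<le> f (T \<inter> W (Suc j)) + f (W j)"
      using f sub unfolding submodular_def by (metis T le_infI1)
    moreover have "T \<inter> W j = W j \<and> T \<inter> W (Suc j) = W (Suc j)"
      if "\<forall>i\<in>T. \<forall>l\<in>{1..n}. \<sigma> i < \<sigma> l \<longrightarrow> l \<in> T"
      using that True WS unfolding W[symmetric] by auto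
    ultimately show ?thesis using Suc sum by auto
  qed
qed

lemma greedy_le:
  assumes "submodular n f" "\<sigma> permutes {1..n}" "T \<subseteq> {1..n}"
  shows "(\<Sum>i\<in>T. lookup_vec (greedy n f \<sigma>) i) \<le> f T"
    and "(\<forall>i\<in>T. \<forall>l\<in>{1..n}. \<sigma> i < \<sigma> l \<longrightarrow> l \<in> T) \<Longrightarrow>
      (\<Sum>i\<in>T. lookup_vec (greedy n f \<sigma>) i) = f T"
proof -
  have "0 < \<sigma> l" if "l \<in> {1..n}" for l
    using permutes_in_image[OF assms(2), of l] that by auto
  then have "T \<inter> {l \<in> {1..n}. n - n < \<sigma> l} = T" using assms(3) by auto
  then show "(\<Sum>i\<in>T. lookup_vec (greedy n f \<sigma>) i) \<le> f T"
    and "(\<forall>i\<in>T. \<forall>l\<in>{1..n}. \<sigma> i < \<sigma> l \<longrightarrow> l \<in> T) \<Longrightarrow>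
      (\<Sum>i\<in>T. lookup_vec (greedy n f \<sigma>) i) = f T"
    using greedy_prefix[OF assms, of n] by auto
qed

lemma greedy_in_base_polytope:
  assumes "submodular n f" "\<sigma> permutes {1..n}"
  shows "greedy n f \<sigma> \<in> base_polytope n f"
proof -
  have "greedy n f \<sigma> \<in> Rn n" unfolding greedy_def Rn_iff by (simp add: lookup_sum_single)
  then show ?thesis
    unfolding base_polytope_def using greedy_le[OF assms] by auto
qed

lemma ex_sorting_bij:
  fixes c :: "'a \<Rightarrow> real"
  assumes "finite X"
  shows "\<exists>\<tau>. bij_betw \<tau> X {1..card X} \<and> (\<forall>i\<in>X. \<forall>j\<in>X. c i < c j \<longrightarrow> \<tau> i < \<tau> j)"
  using assms
proof (induction X rule: finite_ranking_induct[where f = c])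
  case empty
  then show ?case by (auto simp: bij_betw_def)
next
  case (insert x S)
  show ?case
  proof (cases "x \<in> S")
    case True
    then show ?thesis using insert by (simp add: insert_absorb)
  next
    case False
    obtain \<tau> where \<tau>: "bij_betw \<tau> S {1..card S}" "\<forall>i\<in>S. \<forall>j\<in>S. c i < c j \<longrightarrow> \<tau> i < \<tau> j"
      using insert by blast
    define \<tau>' where "\<tau>' = \<tau>(x := Suc (card S))"
    have "bij_betw \<tau>' S {1..card S}"
      using \<tau>(1) False by (subst bij_betw_cong[where g = \<tau>]) (auto simp: \<tau>'_def)
    then have "bij_betw \<tau>' (S \<union> {x}) ({1..card S} \<union> {\<tau>' x})"
      using False by (subst notIn_Un_bij_betw3[symmetric]) (auto simp: \<tau>'_def)
    moreover have "{1..card S} \<union> {\<tau>' x} = {1..card (insert x S)}"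
      using False insert.hyps by (auto simp: \<tau>'_def)
    ultimately have "bij_betw \<tau>' (insert x S) {1..card (insert x S)}" by simp
    moreover have "\<tau>' i < \<tau>' j" if ij: "i \<in> insert x S" "j \<in> insert x S" "c i < c j" for i j
    proof -
      have i: "i \<noteq> x" using ij insert.hyps(2) by (metis insert_iff less_irrefl not_le)
      then have "\<tau> i \<in> {1..card S}" using \<tau>(1) ij(1) by (auto dest: bij_betwE)
      then show ?thesis using i ij \<tau>(2) unfolding \<tau>'_def by auto
    qed
    ultimately show ?thesis by blast
  qed
qed

lemma ex_sorting_permutation:
  fixes c :: "nat \<Rightarrow> real"
  shows "\<exists>\<sigma>. \<sigma> permutes {1..n} \<and> (\<forall>i\<in>{1..n}. \<forall>j\<in>{1..n}. c i < c j \<longrightarrow> \<sigma> i < \<sigma> j)"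
proof -
  obtain \<tau> where \<tau>: "bij_betw \<tau> {1..n} {1..n}"
    "\<forall>i\<in>{1..n}. \<forall>j\<in>{1..n}. c i < c j \<longrightarrow> \<tau> i < \<tau> j"
    using ex_sorting_bij[of "{1..n}" c] by auto
  define \<sigma> where "\<sigma> i = (if i \<in> {1..n} then \<tau> i else i)" for i
  have "bij_betw \<sigma> {1..n} {1..n}"
    using \<tau>(1) by (subst bij_betw_cong[where g = \<tau>]) (auto simp: \<sigma>_def)
  then have "\<sigma> permutes {1..n}" by (rule bij_imp_permutes) (auto simp: \<sigma>_def)
  moreover have "\<forall>i\<in>{1..n}. \<forall>j\<in>{1..n}. c i < c j \<longrightarrow> \<sigma> i < \<sigma> j"
    using \<tau>(2) by (simp add: \<sigma>_def)
  ultimately show ?thesis by blast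
qed

text \<open>Sorting by the indicator of \<open>T\<close> gives \<open>T\<close> the largest
  positions, so it is a prefix of the greedy order and the greedy vector is tight on it.\<close>

lemma ex_tight_point:
  assumes "submodular n f" "T \<subseteq> {1..n}"
  shows "\<exists>x\<in>base_polytope n f. (\<Sum>i\<in>T. lookup_vec x i) = f T"
proof -
  obtain \<sigma> where \<sigma>: "\<sigma> permutes {1..n}"
    "\<forall>i\<in>{1..n}. \<forall>j\<in>{1..n}. (if i \<in> T then 1 else 0::real) < (if j \<in> T then 1 else 0) \<longrightarrow> \<sigma> i < \<sigma> j"
    using ex_sorting_permutation[of n "\<lambda>i. if i \<in> T then 1 else 0"] by auto
  have "\<forall>i\<in>T. \<forall>l\<in>{1..n}. \<sigma> i < \<sigma> l \<longrightarrow> l \<in> T"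
  proof (intro ballI impI)
    fix i l assume il: "i \<in> T" "l \<in> {1..n}" "\<sigma> i < \<sigma> l"
    show "l \<in> T"
    proof (rule ccontr)
      assume "l \<notin> T"
      then have "\<sigma> l < \<sigma> i" using \<sigma>(2)[rule_format, of l i] il assms(2) by auto
      then show False using il(3) by simp
    qed
  qed
  then show ?thesis
    using greedy_le(2)[OF assms(1) \<sigma>(1) assms(2)] greedy_in_base_polytope[OF assms(1) \<sigma>(1)] by blast
qed

section \<open>The permutahedron as a base polytope\<close>

definition top_sum :: "nat \<Rightarrow> nat \<Rightarrow> real" where
  "top_sum n t = real t * real n - real t * (real t - 1) / 2"

lemma sum_eq_top_sum:
  assumes "t \<le> n"
  shows "(\<Sum>l\<in>{n + 1 - t..n}. real l) = top_sum n t"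
  using assms
proof (induction t)
  case 0
  then show ?case by (simp add: top_sum_def)
next
  case (Suc t)
  have "{n + 1 - Suc t..n} = insert (n - t) {n + 1 - t..n}" using Suc.prems by auto
  then have "(\<Sum>l\<in>{n + 1 - Suc t..n}. real l) = real (n - t) + top_sum n t"
    using Suc by simp
  also have "\<dots> = top_sum n (Suc t)"
    using Suc.prems by (simp add: top_sum_def of_nat_diff field_simps)
  finally show ?case .
qed

text \<open>For incomparable \<open>S\<close> and \<open>T\<close> the gap of the unperturbed,
  unhalved function is exactly the product of the sizes of the two differences, hence at least 1.
  The changes of \<open>\<delta>\<close> from \<open>S\<close> to \<open>S \<union> T\<close> and
  from \<open>T\<close> to \<open>S \<inter> T\<close> use up at most that much.\<close>

lemma submodular_perturbed:
  assumes "\<delta> {} = 0" and "\<And>S T. \<delta> S - \<delta> T \<le> 1 / 2"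
  shows "submodular n (\<lambda>T. (top_sum n (card T) + \<delta> T) / 2)"
  unfolding submodular_def
proof (intro conjI allI impI)
  show "(top_sum n (card {}) + \<delta> {}) / 2 = 0" using assms(1) by (simp add: top_sum_def)
  fix S T assume S: "S \<subseteq> {1..n}" and T: "T \<subseteq> {1..n}"
  have fin: "finite S" "finite T" using S T finite_subset by auto
  show "(top_sum n (card (S \<union> T)) + \<delta> (S \<union> T)) / 2 + (top_sum n (card (S \<inter> T)) + \<delta> (S \<inter> T)) / 2
    \<le> (top_sum n (card S) + \<delta> S) / 2 + (top_sum n (card T) + \<delta> T) / 2"
  proof (cases "S \<subseteq> T \<or> T \<subseteq> S")
    case True
    then show ?thesis by (auto simp: Un_absorb1 Un_absorb2 Int_absorb1 Int_absorb2)
  next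
    case False
    define a b c where "a = real (card (S - T))" "b = real (card (T - S))" "c = real (card (S \<inter> T))"
    have "card (S - T) \<noteq> 0" "card (T - S) \<noteq> 0" using False fin by auto
    then have ab: "a \<ge> 1" "b \<ge> 1" unfolding a_b_c_def by auto
    have cS: "real (card S) = a + c" unfolding a_b_c_def
      using card_Int_Diff[OF fin(1), of T] by (simp add: Int_commute)
    have cT: "real (card T) = b + c" unfolding a_b_c_def
      using card_Int_Diff[OF fin(2), of S] by (simp add: Int_commute)
    have "card S + card T = card (S \<union> T) + card (S \<inter> T)" by (rule card_Un_Int[OF fin])
    then have cU: "real (card (S \<union> T)) = a + b + c"
      using cS cT unfolding a_b_c_def(3) by linarith
    have "top_sum n (card S) + top_sum n (card T) - top_sum n (card (S \<union> T)) - top_sum n (card (S \<inter> T))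
      = a * b"
      unfolding top_sum_def cS cT cU a_b_c_def(3)[symmetric] by (simp add: field_simps)
    moreover have "a * b \<ge> 1" using ab mult_mono[of 1 a 1 b] by simp
    moreover have "(w + dU) / 2 + (z + dI) / 2 \<le> (u + dS) / 2 + (v + dT) / 2"
      if "u + v - w - z = p" "1 \<le> p" "dU - dS \<le> 1 / 2" "dI - dT \<le> 1 / 2"
      for u v w z p dU dI dS dT :: real
      using that by (simp add: field_simps)
    ultimately show ?thesis using assms(2)[of "S \<union> T" S] assms(2)[of "S \<inter> T" T] by blast
  qed
qed

definition permvec :: "nat \<Rightarrow> (nat \<Rightarrow> nat) \<Rightarrow> rvec" where
  "permvec n \<sigma> = (\<Sum>i\<in>{1..n}. Poly_Mapping.single i (real (\<sigma> i)))"

lemma permutahedron_eq: "permutahedron n = convex hull (permvec n ` {\<sigma>. \<sigma> permutes {1..n}})"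
  unfolding permutahedron_def permvec_def by (simp add: setcompr_eq_image)

lemma lookup_permvec: "lookup_vec (permvec n \<sigma>) i = (if i \<in> {1..n} then real (\<sigma> i) else 0)"
  unfolding permvec_def by (simp add: lookup_sum_single)

text \<open>Going from \<open>t\<close> to \<open>t + 1\<close> elements raises
  \<open>top_sum n\<close> by \<open>n - t\<close>, and exactly \<open>n - \<sigma> i\<close>
  elements precede \<open>i\<close> in the greedy order.\<close>

lemma greedy_top_sum:
  assumes \<sigma>: "\<sigma> permutes {1..n}"
  shows "greedy n (\<lambda>T. top_sum n (card T)) \<sigma> = permvec n \<sigma>"
proof -
  have card: "card {l \<in> {1..n}. k < \<sigma> l} = n - k" for k
  proof -
    have "\<sigma> ` {l \<in> {1..n}. k < \<sigma> l} = {k<..n}"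
    proof
      show "\<sigma> ` {l \<in> {1..n}. k < \<sigma> l} \<subseteq> {k<..n}"
      proof (rule image_subsetI)
        fix l assume "l \<in> {l \<in> {1..n}. k < \<sigma> l}"
        then show "\<sigma> l \<in> {k<..n}" using permutes_in_image[OF \<sigma>, of l] by simp
      qed
      show "{k<..n} \<subseteq> \<sigma> ` {l \<in> {1..n}. k < \<sigma> l}"
      proof
        fix j assume j: "j \<in> {k<..n}"
        then have "j \<in> \<sigma> ` {1..n}" using permutes_image[OF \<sigma>] by auto
        then show "j \<in> \<sigma> ` {l \<in> {1..n}. k < \<sigma> l}" using j by auto
      qed
    qed
    moreover have "inj_on \<sigma> {l \<in> {1..n}. k < \<sigma> l}"
      using permutes_inj[OF \<sigma>] by (rule inj_on_subset) auto
    ultimately show ?thesis by (metis card_greaterThanAtMost card_image)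
  qed
  have "top_sum n (card {l \<in> {1..n}. \<sigma> i \<le> \<sigma> l}) - top_sum n (card {l \<in> {1..n}. \<sigma> i < \<sigma> l})
      = real (\<sigma> i)" if i: "i \<in> {1..n}" for i
  proof -
    have si: "\<sigma> i \<in> {1..n}" using permutes_in_image[OF \<sigma>] i by blast
    have "{l \<in> {1..n}. \<sigma> i \<le> \<sigma> l} = {l \<in> {1..n}. \<sigma> i - 1 < \<sigma> l}" using si by auto
    then have "card {l \<in> {1..n}. \<sigma> i \<le> \<sigma> l} = Suc (n - \<sigma> i)" using card[of "\<sigma> i - 1"] si by auto
    then show ?thesis using card[of "\<sigma> i"] si
      by (simp add: top_sum_def of_nat_diff field_simps)
  qed
  then show ?thesis unfolding greedy_def permvec_def by (intro sum.cong) auto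
qed

text \<open>Abel summation from the top: extending a suffix downwards replaces its comparison
  coefficient by a smaller one, which is harmless as suffix sums are nonnegative. For the full range
  the comparison term is \<open>a 1\<close> times the total, so it is 0 whatever the sign of
  \<open>a 1\<close>.\<close>

lemma abel_sum_nonneg:
  fixes a y :: "nat \<Rightarrow> real"
  assumes mono: "\<And>i j. 1 \<le> i \<Longrightarrow> i \<le> j \<Longrightarrow> j \<le> n \<Longrightarrow> a i \<le> a j"
    and suffix: "\<And>m. 1 \<le> m \<Longrightarrow> m \<le> n \<Longrightarrow> 0 \<le> (\<Sum>l\<in>{m..n}. y l)"
    and total: "(\<Sum>l\<in>{1..n}. y l) = 0"
  shows "0 \<le> (\<Sum>l\<in>{1..n}. a l * y l)"
proof (cases "n = 0")
  case False
  have "a (n - k) * (\<Sum>l\<in>{n - k..n}. y l) \<le> (\<Sum>l\<in>{n - k..n}. a l * y l)" if "k < n" for k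
    using that
  proof (induction k)
    case (Suc k)
    have "{n - Suc k..n} = insert (n - Suc k) {n - k..n}" using Suc.prems by auto
    moreover have "n - Suc k \<notin> {n - k..n}" using Suc.prems by auto
    moreover have "a (n - Suc k) * (\<Sum>l\<in>{n - k..n}. y l) \<le> a (n - k) * (\<Sum>l\<in>{n - k..n}. y l)"
      using Suc.prems by (intro mult_right_mono mono suffix) auto
    ultimately show ?case using Suc by (simp add: distrib_left)
  qed simp
  from this[of "n - 1"] False show ?thesis using total by simp
qed simp

text \<open>In the order that sorts \<open>c\<close>, each top block of coordinates of
  \<open>x\<close> sums to at most that of \<open>permvec n \<sigma>\<close>, because
  \<open>t\<close> coordinates are bounded by the sum of the \<open>t\<close> largest values. Abel
  summation turns this into the comparison for \<open>c\<close>.\<close>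

lemma sorted_permvec_maximal:
  assumes x: "x \<in> base_polytope n (\<lambda>T. top_sum n (card T))"
  shows "\<exists>\<sigma>. \<sigma> permutes {1..n} \<and> dot n c x \<le> dot n c (permvec n \<sigma>)"
proof -
  obtain \<sigma> where \<sigma>: "\<sigma> permutes {1..n}"
    and sorted: "\<And>i j. i \<in> {1..n} \<Longrightarrow> j \<in> {1..n} \<Longrightarrow> lookup_vec c i < lookup_vec c j \<Longrightarrow> \<sigma> i < \<sigma> j"
    using ex_sorting_permutation[of n "lookup_vec c"] by auto
  define \<tau> where "\<tau> = inv \<sigma>"
  have \<tau>: "\<tau> permutes {1..n}" unfolding \<tau>_def by (rule permutes_inv[OF \<sigma>])
  have st: "\<sigma> (\<tau> j) = j" for j unfolding \<tau>_def using permutes_inverses[OF \<sigma>] by simp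
  have t_in: "\<tau> j \<in> {1..n} \<longleftrightarrow> j \<in> {1..n}" for j by (rule permutes_in_image[OF \<tau>])
  define y where "y l = real l - lookup_vec x (\<tau> l)" for l
  have inj: "inj_on \<tau> S" for S using permutes_inj[OF \<tau>] by (rule inj_on_subset) auto
  have suffix: "(\<Sum>l\<in>{m..n}. y l) = top_sum n (n + 1 - m) - (\<Sum>i\<in>\<tau> ` {m..n}. lookup_vec x i)"
    if "1 \<le> m" "m \<le> n + 1" for m
  proof -
    have "{n + 1 - (n + 1 - m)..n} = {m..n}" using that by auto
    then have "(\<Sum>l\<in>{m..n}. real l) = top_sum n (n + 1 - m)"
      using sum_eq_top_sum[of "n + 1 - m" n] that by simp
    then show ?thesis unfolding y_def by (simp add: sum_subtractf sum.reindex[OF inj])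
  qed
  have "0 \<le> (\<Sum>l\<in>{1..n}. lookup_vec c (\<tau> l) * y l)"
  proof (rule abel_sum_nonneg)
    show "lookup_vec c (\<tau> i) \<le> lookup_vec c (\<tau> j)" if "1 \<le> i" "i \<le> j" "j \<le> n" for i j
    proof (rule ccontr)
      assume "\<not> lookup_vec c (\<tau> i) \<le> lookup_vec c (\<tau> j)"
      then have "\<sigma> (\<tau> j) < \<sigma> (\<tau> i)"
        using t_in[of i] t_in[of j] that by (intro sorted) simp_all
      then show False using that(2) unfolding st by simp
    qed
    show "0 \<le> (\<Sum>l\<in>{m..n}. y l)" if m: "1 \<le> m" "m \<le> n" for m
    proof -
      have "\<tau> ` {m..n} \<subseteq> {1..n}"
        by (rule image_subsetI, subst t_in) (use m in simp)
      then have "(\<Sum>i\<in>\<tau> ` {m..n}. lookup_vec x i) \<le> top_sum n (card (\<tau> ` {m..n}))"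
        using x unfolding base_polytope_def by blast
      then show ?thesis using suffix[of m] m card_image[OF inj, of "{m..n}"] by simp
    qed
    show "(\<Sum>l\<in>{1..n}. y l) = 0"
      using suffix[of 1] permutes_image[OF \<tau>] x unfolding base_polytope_def by simp
  qed
  also have "(\<Sum>l\<in>{1..n}. lookup_vec c (\<tau> l) * y l)
      = (\<Sum>l\<in>{1..n}. lookup_vec c (\<tau> l) * (real (\<sigma> (\<tau> l)) - lookup_vec x (\<tau> l)))"
    unfolding y_def st by simp
  also have "\<dots> = (\<Sum>i\<in>\<tau> ` {1..n}. lookup_vec c i * (real (\<sigma> i) - lookup_vec x i))"
    by (simp add: sum.reindex[OF inj])
  also have "\<dots> = dot n c (permvec n \<sigma>) - dot n c x"
    unfolding permutes_image[OF \<tau>] dot_def sum_subtractf[symmetric]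
    by (intro sum.cong) (auto simp: lookup_permvec algebra_simps)
  finally show ?thesis using \<sigma> by auto
qed

text \<open>Farkas' lemma with exchanged roles: the variables are affine functionals
  \<open>(c, t)\<close> and the constraints are vertices, \<open>ev v\<close> being evaluation at
  \<open>v\<close>. A functional nonpositive at all vertices is nonpositive at \<open>x\<close>; the
  resulting multipliers sum to 1 because of the coordinate \<open>t\<close>.\<close>

lemma base_polytope_subset_permutahedron:
  "base_polytope n (\<lambda>T. top_sum n (card T)) \<subseteq> permutahedron n"
proof
  fix x assume x: "x \<in> base_polytope n (\<lambda>T. top_sum n (card T))"
  define Perms where "Perms = {\<sigma>. \<sigma> permutes {1..n}}"
  have fin: "finite Perms" unfolding Perms_def by (rule finite_permutations) simp
  define ev where "ev v = (\<lambda>(c, t). dot n c v + t)" for v :: rvec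
  have lin: "linear (ev v)" for v
    unfolding ev_def linear_iff dot_def
    by (auto simp: lookup_add algebra_simps sum.distrib sum_distrib_left)
  have "\<exists>l. (\<forall>\<sigma>\<in>Perms. l \<sigma> \<ge> 0) \<and>
      (\<forall>z\<in>Rn n \<times> UNIV. ev x z = (\<Sum>\<sigma>\<in>Perms. l \<sigma> * ev (permvec n \<sigma>) z))"
  proof (rule farkas[OF fin])
    show "subspace (Rn n \<times> (UNIV::real set))" using subspace_Rn by (intro subspace_Times) auto
    fix z :: "rvec \<times> real" assume le: "\<And>\<sigma>. \<sigma> \<in> Perms \<Longrightarrow> ev (permvec n \<sigma>) z \<le> 0"
    obtain c t where z: "z = (c, t)" by (cases z)
    obtain \<sigma> where "\<sigma> \<in> Perms" "dot n c x \<le> dot n c (permvec n \<sigma>)"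
      using sorted_permvec_maximal[OF x, of c] unfolding Perms_def by auto
    then show "ev x z \<le> 0" using le[of \<sigma>] unfolding z ev_def by auto
  qed (use lin in auto)
  then obtain l where l: "\<And>\<sigma>. \<sigma> \<in> Perms \<Longrightarrow> l \<sigma> \<ge> 0"
    and eq: "\<And>c t. c \<in> Rn n \<Longrightarrow>
      dot n c x + t = (\<Sum>\<sigma>\<in>Perms. l \<sigma> * (dot n c (permvec n \<sigma>) + t))"
    unfolding ev_def by auto
  have one: "(\<Sum>\<sigma>\<in>Perms. l \<sigma>) = 1"
    using eq[of 0 1] by (simp add: Rn_iff dot_def)
  have xR: "x \<in> Rn n" using x unfolding base_polytope_def by auto
  have "x = (\<Sum>\<sigma>\<in>Perms. l \<sigma> *\<^sub>R permvec n \<sigma>)"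
  proof (rule poly_mapping_eqI)
    fix i
    show "lookup_vec x i = lookup_vec (\<Sum>\<sigma>\<in>Perms. l \<sigma> *\<^sub>R permvec n \<sigma>) i"
    proof (cases "i \<in> {1..n}")
      case True
      then show ?thesis
        using eq[of "charvec {i}" 0] charvec_in_Rn[of "{i}" n]
        by (simp add: dot_charvec lookup_sum)
    next
      case False
      then show ?thesis using xR by (auto simp: lookup_sum lookup_permvec Rn_iff)
    qed
  qed
  moreover have "(\<Sum>\<sigma>\<in>Perms. l \<sigma> *\<^sub>R permvec n \<sigma>) \<in> permutahedron n"
    unfolding permutahedron_eq
    by (rule convex_sum[OF fin]) (use one l in \<open>auto simp: Perms_def intro: hull_inc\<close>)
  ultimately show "x \<in> permutahedron n" by simp
qed

section \<open>Minkowski sums of base polytopes\<close>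

lemma convex_base_polytope: "convex (base_polytope n f)"
  unfolding base_polytope_eq_solutions by (rule convex_solutions)

lemma base_polytope_sum_subset:
  assumes "p \<in> base_polytope n f" "q \<in> base_polytope n g"
  shows "p + q \<in> base_polytope n (\<lambda>T. f T + g T)"
  unfolding base_polytope_def
proof (intro CollectI conjI allI impI)
  show "p + q \<in> Rn n"
    using assms unfolding base_polytope_def by (intro subspace_add[OF subspace_Rn]) auto
  show "(\<Sum>i\<in>T. lookup_vec (p + q) i) \<le> f T + g T" if "T \<subseteq> {1..n}" for T
    unfolding lookup_add sum.distrib
    using assms that unfolding base_polytope_def by (intro add_mono) auto
  show "(\<Sum>i\<in>{1..n}. lookup_vec (p + q) i) = f {1..n} + g {1..n}"
    unfolding lookup_add sum.distrib using assms unfolding base_polytope_def by simp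
qed

text \<open>For fixed \<open>\<sigma>\<close> the greedy vector is additive in the set function, so
  each vertex of the permutahedron splits, and the sum is convex. Conversely, inequalities of the
  two points add up.\<close>

lemma minkowski_sum_base_polytopes:
  assumes f: "submodular n f" and g: "submodular n g"
    and fg: "\<And>T. T \<subseteq> {1..n} \<Longrightarrow> f T + g T = top_sum n (card T)"
  shows "minkowski_sum (base_polytope n f) (base_polytope n g) = permutahedron n"
proof
  have eq: "base_polytope n (\<lambda>T. f T + g T) = base_polytope n (\<lambda>T. top_sum n (card T))"
    unfolding base_polytope_def using fg by auto
  show "minkowski_sum (base_polytope n f) (base_polytope n g) \<subseteq> permutahedron n"
  proof
    fix x assume "x \<in> minkowski_sum (base_polytope n f) (base_polytope n g)"
    then obtain p q where "x = p + q" "p \<in> base_polytope n f" "q \<in> base_polytope n g"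
      unfolding minkowski_sum_def by blast
    then have "x \<in> base_polytope n (\<lambda>T. top_sum n (card T))"
      using base_polytope_sum_subset eq by blast
    then show "x \<in> permutahedron n" using base_polytope_subset_permutahedron by blast
  qed
  show "permutahedron n \<subseteq> minkowski_sum (base_polytope n f) (base_polytope n g)"
    unfolding permutahedron_eq
  proof (rule hull_minimal)
    have "minkowski_sum (base_polytope n f) (base_polytope n g) =
        (\<Union>x\<in>base_polytope n f. \<Union>y\<in>base_polytope n g. {x + y})"
      unfolding minkowski_sum_def by auto
    then show "convex (minkowski_sum (base_polytope n f) (base_polytope n g))"
      using convex_sums[OF convex_base_polytope convex_base_polytope] by simp
    have "permvec n \<sigma> = greedy n f \<sigma> + greedy n g \<sigma>" if "\<sigma> permutes {1..n}" for \<sigma>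
    proof -
      have "greedy n f \<sigma> + greedy n g \<sigma> = greedy n (\<lambda>T. f T + g T) \<sigma>"
        unfolding greedy_def sum.distrib[symmetric]
        by (intro sum.cong) (auto simp: single_add[symmetric] algebra_simps)
      also have "\<dots> = greedy n (\<lambda>T. top_sum n (card T)) \<sigma>"
        unfolding greedy_def by (intro sum.cong arg_cong2[where f = Poly_Mapping.single] arg_cong2[where f = "(-)"] fg) auto
      finally show ?thesis using greedy_top_sum[OF that] by simp
    qed
    then show "permvec n ` {\<sigma>. \<sigma> permutes {1..n}} \<subseteq> minkowski_sum (base_polytope n f) (base_polytope n g)"
      unfolding minkowski_sum_def using greedy_in_base_polytope[OF f] greedy_in_base_polytope[OF g]
      by blast
  qed
qed

lemma permutahedron_eq_base_polytope:
  "permutahedron n = base_polytope n (\<lambda>T. top_sum n (card T))"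
proof
  \<comment> \<open>Half of the function, without perturbation: the permutahedron is the sum of two
    copies of this base polytope, whose inequalities add up to the required ones.\<close>
  let ?f = "\<lambda>T. (top_sum n (card T) + 0) / 2"
  have sub: "submodular n ?f" by (rule submodular_perturbed) auto
  have "permutahedron n = minkowski_sum (base_polytope n ?f) (base_polytope n ?f)"
    using minkowski_sum_base_polytopes[OF sub sub] by simp
  also have "\<dots> \<subseteq> base_polytope n (\<lambda>T. top_sum n (card T))"
  proof
    fix x assume "x \<in> minkowski_sum (base_polytope n ?f) (base_polytope n ?f)"
    then obtain p q where "x = p + q" "p \<in> base_polytope n ?f" "q \<in> base_polytope n ?f"
      unfolding minkowski_sum_def by blast
    then have "x \<in> base_polytope n (\<lambda>T. ?f T + ?f T)" using base_polytope_sum_subset by blast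
    then show "x \<in> base_polytope n (\<lambda>T. top_sum n (card T))" by simp
  qed
  finally show "permutahedron n \<subseteq> base_polytope n (\<lambda>T. top_sum n (card T))" .
qed (rule base_polytope_subset_permutahedron)

lemma permvec_in_permutahedron: "\<sigma> permutes {1..n} \<Longrightarrow> permvec n \<sigma> \<in> permutahedron n"
  unfolding permutahedron_eq by (intro hull_inc) auto

lemma polytope_in_permutahedron: "polytope_in n (permutahedron n)"
  using permvec_in_permutahedron[OF permutes_id] unfolding permutahedron_eq_base_polytope
  by (intro polytope_in_base_polytope) auto

section \<open>The Birkhoff polytope as an extension\<close>

lemma weighted_sum_le_top_sum:
  fixes w :: "nat \<Rightarrow> real"
  assumes w: "\<And>j. j \<in> {1..n} \<Longrightarrow> 0 \<le> w j" "\<And>j. j \<in> {1..n} \<Longrightarrow> w j \<le> 1"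
    and t: "(\<Sum>j\<in>{1..n}. w j) = real t" "t \<le> n"
  shows "(\<Sum>j\<in>{1..n}. real j * w j) \<le> top_sum n t"
proof -
  \<comment> \<open>The shift makes \<open>real j - ?d\<close> positive exactly for the
    \<open>t\<close> largest indices; there \<open>w j\<close> is replaced by 1 and elsewhere by
    0.\<close>
  let ?d = "real n - real t"
  have "(\<Sum>j\<in>{1..n}. (real j - ?d) * w j) \<le> (\<Sum>j\<in>{1..n}. if j \<in> {n + 1 - t..n} then real j - ?d else 0)"
  proof (rule sum_mono)
    fix j assume j: "j \<in> {1..n}"
    show "(real j - ?d) * w j \<le> (if j \<in> {n + 1 - t..n} then real j - ?d else 0)"
    proof (cases "j \<in> {n + 1 - t..n}")
      case True
      then have "real j - ?d \<ge> 0" using t(2) by auto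
      then show ?thesis using w(2)[OF j] True by (simp add: mult_left_le)
    next
      case False
      then have "real j - ?d \<le> 0" using j t(2) by auto
      then show ?thesis using w(1)[OF j] False by (simp add: mult_nonpos_nonneg)
    qed
  qed
  also have "\<dots> = (\<Sum>j\<in>{n + 1 - t..n}. real j - ?d)"
  proof -
    have "{1..n} \<inter> {n + 1 - t..n} = {n + 1 - t..n}" using t(2) by auto
    then show ?thesis
      using sum.inter_restrict[OF finite_atLeastAtMost, of "\<lambda>j. real j - ?d" 1 n "{n + 1 - t..n}"]
      by (simp only:)
  qed
  also have "\<dots> = top_sum n t - real t * ?d"
    using sum_eq_top_sum[OF t(2)] t(2) by (simp add: sum_subtractf)
  also have "(\<Sum>j\<in>{1..n}. (real j - ?d) * w j) = (\<Sum>j\<in>{1..n}. real j * w j) - ?d * real t"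
    unfolding t(1)[symmetric] by (simp add: left_diff_distrib sum_subtractf sum_distrib_left)
  finally show ?thesis by simp
qed

text \<open>The doubly stochastic matrices: \<open>\<beta>\<close> flattens position
  \<open>(i, j)\<close> into a coordinate, and each row or column equation is split into two
  inequalities.\<close>

definition birkhoff_ineqs :: "nat \<Rightarrow> (nat \<times> nat \<Rightarrow> nat) \<Rightarrow> (rvec \<times> real) set" where
  "birkhoff_ineqs n \<beta> =
     (\<lambda>ij. (- charvec {\<beta> ij}, 0)) ` ({1..n} \<times> {1..n}) \<union>
     (\<lambda>i. (charvec ((\<lambda>j. \<beta> (i, j)) ` {1..n}), 1)) ` {1..n} \<union>
     (\<lambda>i. (- charvec ((\<lambda>j. \<beta> (i, j)) ` {1..n}), - 1)) ` {1..n} \<union>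
     (\<lambda>j. (charvec ((\<lambda>i. \<beta> (i, j)) ` {1..n}), 1)) ` {1..n} \<union>
     (\<lambda>j. (- charvec ((\<lambda>i. \<beta> (i, j)) ` {1..n}), - 1)) ` {1..n}"

lemma finite_birkhoff_ineqs: "finite (birkhoff_ineqs n \<beta>)"
  unfolding birkhoff_ineqs_def by auto

lemma card_birkhoff_ineqs: "card (birkhoff_ineqs n \<beta>) \<le> n * n + 4 * n"
proof -
  have "card (f ` {1..n}) \<le> n" for f :: "nat \<Rightarrow> rvec \<times> real"
    using card_image_le[of "{1..n}" f] by simp
  moreover have "card (f ` ({1..n} \<times> {1..n})) \<le> n * n" for f :: "nat \<times> nat \<Rightarrow> rvec \<times> real"
    using card_image_le[of "{1..n} \<times> {1..n}" f] by simp
  ultimately have "card (birkhoff_ineqs n \<beta>) \<le> n * n + n + n + n + n"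
    unfolding birkhoff_ineqs_def by (intro card_Un_le[THEN order_trans] add_mono)
  then show ?thesis by simp
qed

lemma birkhoff_iff:
  assumes \<beta>: "bij_betw \<beta> ({1..n} \<times> {1..n}) {1..m}"
  shows "x \<in> solutions m (birkhoff_ineqs n \<beta>) \<longleftrightarrow> x \<in> Rn m \<and>
    (\<forall>i\<in>{1..n}. \<forall>j\<in>{1..n}. 0 \<le> lookup_vec x (\<beta> (i, j))) \<and>
    (\<forall>i\<in>{1..n}. (\<Sum>j\<in>{1..n}. lookup_vec x (\<beta> (i, j))) = 1) \<and>
    (\<forall>j\<in>{1..n}. (\<Sum>i\<in>{1..n}. lookup_vec x (\<beta> (i, j))) = 1)"
proof -
  have inj: "inj_on \<beta> ({1..n} \<times> {1..n})" and im: "\<And>i j. i \<in> {1..n} \<Longrightarrow> j \<in> {1..n} \<Longrightarrow> \<beta> (i, j) \<in> {1..m}"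
    using \<beta> unfolding bij_betw_def by auto
  have row: "dot m (charvec ((\<lambda>j. \<beta> (i, j)) ` {1..n})) x = (\<Sum>j\<in>{1..n}. lookup_vec x (\<beta> (i, j)))"
    if i: "i \<in> {1..n}" for i
  proof -
    have "inj_on (\<lambda>j. \<beta> (i, j)) {1..n}"
    proof (rule inj_onI)
      fix j j' assume "j \<in> {1..n}" "j' \<in> {1..n}" "\<beta> (i, j) = \<beta> (i, j')"
      then have "(i, j) = (i, j')" using i by (intro inj_onD[OF inj]) blast+
      then show "j = j'" by simp
    qed
    moreover have "(\<lambda>j. \<beta> (i, j)) ` {1..n} \<subseteq> {1..m}" using im[OF i] by blast
    ultimately show ?thesis by (simp add: dot_charvec sum.reindex)
  qed
  have col: "dot m (charvec ((\<lambda>i. \<beta> (i, j)) ` {1..n})) x = (\<Sum>i\<in>{1..n}. lookup_vec x (\<beta> (i, j)))"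
    if j: "j \<in> {1..n}" for j
  proof -
    have "inj_on (\<lambda>i. \<beta> (i, j)) {1..n}"
    proof (rule inj_onI)
      fix i i' assume "i \<in> {1..n}" "i' \<in> {1..n}" "\<beta> (i, j) = \<beta> (i', j)"
      then have "(i, j) = (i', j)" using j by (intro inj_onD[OF inj]) blast+
      then show "i = i'" by simp
    qed
    moreover have "(\<lambda>i. \<beta> (i, j)) ` {1..n} \<subseteq> {1..m}" using im[OF _ j] by blast
    ultimately show ?thesis by (simp add: dot_charvec sum.reindex)
  qed
  have entry: "dot m (charvec {\<beta> ij}) x = lookup_vec x (\<beta> ij)" if "ij \<in> {1..n} \<times> {1..n}" for ij
    using im[of "fst ij" "snd ij"] that by (subst dot_charvec) auto
  have "x \<in> solutions m (birkhoff_ineqs n \<beta>) \<longleftrightarrow> x \<in> Rn m \<and>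
    (\<forall>ij\<in>{1..n} \<times> {1..n}. - lookup_vec x (\<beta> ij) \<le> 0) \<and>
    (\<forall>i\<in>{1..n}. (\<Sum>j\<in>{1..n}. lookup_vec x (\<beta> (i, j))) \<le> 1) \<and>
    (\<forall>i\<in>{1..n}. - (\<Sum>j\<in>{1..n}. lookup_vec x (\<beta> (i, j))) \<le> - 1) \<and>
    (\<forall>j\<in>{1..n}. (\<Sum>i\<in>{1..n}. lookup_vec x (\<beta> (i, j))) \<le> 1) \<and>
    (\<forall>j\<in>{1..n}. - (\<Sum>i\<in>{1..n}. lookup_vec x (\<beta> (i, j))) \<le> - 1)"
    unfolding solutions_def birkhoff_ineqs_def mem_Collect_eq ball_Un ball_simps(9) split_conv
      dot_minus_left
    by (simp only: row col entry conj_assoc cong: ball_cong)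
  also have "\<dots> \<longleftrightarrow> x \<in> Rn m \<and>
    (\<forall>i\<in>{1..n}. \<forall>j\<in>{1..n}. 0 \<le> lookup_vec x (\<beta> (i, j))) \<and>
    (\<forall>i\<in>{1..n}. (\<Sum>j\<in>{1..n}. lookup_vec x (\<beta> (i, j))) = 1) \<and>
    (\<forall>j\<in>{1..n}. (\<Sum>i\<in>{1..n}. lookup_vec x (\<beta> (i, j))) = 1)"
  proof -
    have "u = 1 \<longleftrightarrow> u \<le> 1 \<and> - u \<le> - 1" for u :: real by auto
    then show ?thesis
      by (simp only: ball_conj_distrib split_paired_Ball_Sigma neg_le_0_iff_le conj_assoc)
  qed
  finally show ?thesis .
qed

text \<open>The matrix applied to the column vector (1, ..., n); the permutation matrix with ones at
  \<open>(i, \<sigma> i)\<close> goes to \<open>permvec n \<sigma>\<close>.\<close>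

definition birkhoff_map :: "nat \<Rightarrow> (nat \<times> nat \<Rightarrow> nat) \<Rightarrow> rvec \<Rightarrow> rvec" where
  "birkhoff_map n \<beta> x =
     (\<Sum>i\<in>{1..n}. Poly_Mapping.single i (\<Sum>j\<in>{1..n}. real j * lookup_vec x (\<beta> (i, j))))"

lemma lookup_birkhoff_map:
  "lookup_vec (birkhoff_map n \<beta> x) i =
    (if i \<in> {1..n} then \<Sum>j\<in>{1..n}. real j * lookup_vec x (\<beta> (i, j)) else 0)"
  unfolding birkhoff_map_def by (simp add: lookup_sum_single)

lemma linear_birkhoff_map: "linear (birkhoff_map n \<beta>)"
  by (intro linearI poly_mapping_eqI)
    (auto simp: lookup_birkhoff_map lookup_add sum.distrib sum_distrib_left algebra_simps)

text \<open>Adding up the rows in \<open>T\<close> of a doubly stochastic matrix gives weights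
  between 0 and 1 with total \<open>card T\<close>, so the image satisfies the base polytope
  inequalities. Permutation matrices reach the vertices.\<close>

lemma birkhoff_map_image:
  assumes \<beta>: "bij_betw \<beta> ({1..n} \<times> {1..n}) {1..m}"
  shows "birkhoff_map n \<beta> ` solutions m (birkhoff_ineqs n \<beta>) = permutahedron n"
proof
  show "birkhoff_map n \<beta> ` solutions m (birkhoff_ineqs n \<beta>) \<subseteq> permutahedron n"
  proof (rule image_subsetI)
    fix x assume "x \<in> solutions m (birkhoff_ineqs n \<beta>)"
    then have nonneg: "\<And>i j. i \<in> {1..n} \<Longrightarrow> j \<in> {1..n} \<Longrightarrow> 0 \<le> lookup_vec x (\<beta> (i, j))"
      and row: "\<And>i. i \<in> {1..n} \<Longrightarrow> (\<Sum>j\<in>{1..n}. lookup_vec x (\<beta> (i, j))) = 1"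
      and col: "\<And>j. j \<in> {1..n} \<Longrightarrow> (\<Sum>i\<in>{1..n}. lookup_vec x (\<beta> (i, j))) = 1"
      unfolding birkhoff_iff[OF \<beta>] by blast+
    have sum: "(\<Sum>i\<in>T. lookup_vec (birkhoff_map n \<beta> x) i) =
        (\<Sum>j\<in>{1..n}. real j * (\<Sum>i\<in>T. lookup_vec x (\<beta> (i, j))))" if T: "T \<subseteq> {1..n}" for T
    proof -
      have "(\<Sum>i\<in>T. lookup_vec (birkhoff_map n \<beta> x) i) =
          (\<Sum>i\<in>T. \<Sum>j\<in>{1..n}. real j * lookup_vec x (\<beta> (i, j)))"
        using T by (intro sum.cong refl) (auto simp: lookup_birkhoff_map)
      also have "\<dots> = (\<Sum>j\<in>{1..n}. \<Sum>i\<in>T. real j * lookup_vec x (\<beta> (i, j)))"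
        by (rule sum.swap)
      finally show ?thesis by (simp add: sum_distrib_left)
    qed
    have "birkhoff_map n \<beta> x \<in> base_polytope n (\<lambda>T. top_sum n (card T))"
      unfolding base_polytope_def
    proof (intro CollectI conjI allI impI)
      show "birkhoff_map n \<beta> x \<in> Rn n" by (auto simp: Rn_iff lookup_birkhoff_map)
      fix T assume T: "T \<subseteq> {1..n}"
      have fin: "finite T" using T finite_subset by auto
      show "(\<Sum>i\<in>T. lookup_vec (birkhoff_map n \<beta> x) i) \<le> top_sum n (card T)"
        unfolding sum[OF T]
      proof (rule weighted_sum_le_top_sum)
        fix j assume j: "j \<in> {1..n}"
        show "0 \<le> (\<Sum>i\<in>T. lookup_vec x (\<beta> (i, j)))"
          by (rule sum_nonneg) (use nonneg j T in blast)
        have "(\<Sum>i\<in>T. lookup_vec x (\<beta> (i, j))) \<le> (\<Sum>i\<in>{1..n}. lookup_vec x (\<beta> (i, j)))"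
          using T nonneg j by (intro sum_mono2) blast+
        then show "(\<Sum>i\<in>T. lookup_vec x (\<beta> (i, j))) \<le> 1" using col[OF j] by simp
      next
        have "(\<Sum>j\<in>{1..n}. \<Sum>i\<in>T. lookup_vec x (\<beta> (i, j))) = (\<Sum>i\<in>T. \<Sum>j\<in>{1..n}. lookup_vec x (\<beta> (i, j)))"
          by (rule sum.swap)
        also have "\<dots> = (\<Sum>i\<in>T. 1)" by (rule sum.cong) (use T row in blast)+
        finally show "(\<Sum>j\<in>{1..n}. \<Sum>i\<in>T. lookup_vec x (\<beta> (i, j))) = real (card T)" by simp
        show "card T \<le> n" using card_mono[OF _ T] by simp
      qed
    next
      have "(\<Sum>i\<in>{1..n}. lookup_vec (birkhoff_map n \<beta> x) i) = (\<Sum>j\<in>{1..n}. real j)"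
        unfolding sum[OF order_refl] by (rule sum.cong) (use col in simp_all)
      then show "(\<Sum>i\<in>{1..n}. lookup_vec (birkhoff_map n \<beta> x) i) = top_sum n (card {1..n})"
        using sum_eq_top_sum[of n n] by simp
    qed
    then show "birkhoff_map n \<beta> x \<in> permutahedron n" by (simp add: permutahedron_eq_base_polytope)
  qed
  show "permutahedron n \<subseteq> birkhoff_map n \<beta> ` solutions m (birkhoff_ineqs n \<beta>)"
    unfolding permutahedron_eq
  proof (rule hull_minimal)
    show "convex (birkhoff_map n \<beta> ` solutions m (birkhoff_ineqs n \<beta>))"
      by (rule convex_linear_image[OF linear_birkhoff_map convex_solutions])
    show "permvec n ` {\<sigma>. \<sigma> permutes {1..n}} \<subseteq> birkhoff_map n \<beta> ` solutions m (birkhoff_ineqs n \<beta>)"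
    proof (rule image_subsetI)
      fix \<sigma> assume "\<sigma> \<in> {\<sigma>. \<sigma> permutes {1..n}}"
      then have \<sigma>: "\<sigma> permutes {1..n}" by simp
      have s_in: "\<sigma> i \<in> {1..n}" if "i \<in> {1..n}" for i using permutes_in_image[OF \<sigma>] that by blast
      define B where "B = (\<lambda>i. \<beta> (i, \<sigma> i)) ` {1..n}"
      define x where "x = charvec B"
      have B: "B \<subseteq> {1..m}" unfolding B_def using s_in bij_betwE[OF \<beta>] by blast
      then have "finite B" using finite_subset by auto
      then have lx: "lookup_vec x k = (if k \<in> B then 1 else 0)" for k
        unfolding x_def by (simp add: lookup_charvec)
      have x: "lookup_vec x (\<beta> (i, j)) = (if j = \<sigma> i then 1 else 0)"
        if "i \<in> {1..n}" "j \<in> {1..n}" for i j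
      proof -
        have "\<beta> (i, j) \<in> B \<longleftrightarrow> j = \<sigma> i"
        proof
          assume "\<beta> (i, j) \<in> B"
          then obtain i' where i': "i' \<in> {1..n}" "\<beta> (i, j) = \<beta> (i', \<sigma> i')" unfolding B_def by blast
          then have "(i, j) = (i', \<sigma> i')"
            using \<beta> that s_in[OF i'(1)] unfolding bij_betw_def by (intro inj_onD[of \<beta>]) auto
          then show "j = \<sigma> i" by simp
        qed (use that in \<open>auto simp: B_def\<close>)
        then show ?thesis using lx by simp
      qed
      have "x \<in> solutions m (birkhoff_ineqs n \<beta>)"
        unfolding birkhoff_iff[OF \<beta>]
      proof (intro conjI ballI)
        show "x \<in> Rn m" unfolding x_def using B by (rule charvec_in_Rn)
        show "0 \<le> lookup_vec x (\<beta> (i, j))" for i j using lx by simp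
        show "(\<Sum>j\<in>{1..n}. lookup_vec x (\<beta> (i, j))) = 1" if i: "i \<in> {1..n}" for i
        proof -
          have "(\<Sum>j\<in>{1..n}. lookup_vec x (\<beta> (i, j))) = (\<Sum>j\<in>{1..n}. if j = \<sigma> i then 1 else 0)"
            by (rule sum.cong) (use x i in simp_all)
          then show ?thesis using s_in[OF i] by simp
        qed
        show "(\<Sum>i\<in>{1..n}. lookup_vec x (\<beta> (i, j))) = 1" if j: "j \<in> {1..n}" for j
        proof -
          have "(\<Sum>i\<in>{1..n}. lookup_vec x (\<beta> (i, j))) = (\<Sum>i\<in>{1..n}. if i = inv \<sigma> j then 1 else 0)"
          proof (rule sum.cong[OF refl])
            fix i assume "i \<in> {1..n}"
            moreover have "j = \<sigma> i \<longleftrightarrow> i = inv \<sigma> j" using permutes_inv_eq[OF \<sigma>, of j i] by metis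
            ultimately show "lookup_vec x (\<beta> (i, j)) = (if i = inv \<sigma> j then 1 else 0)"
              using x j by simp
          qed
          moreover have "inv \<sigma> j \<in> {1..n}"
            using permutes_in_image[OF permutes_inv[OF \<sigma>]] j by blast
          ultimately show ?thesis by simp
        qed
      qed
      moreover have "permvec n \<sigma> = birkhoff_map n \<beta> x"
      proof (rule poly_mapping_eqI)
        fix i
        have "(\<Sum>j\<in>{1..n}. real j * lookup_vec x (\<beta> (i, j))) = real (\<sigma> i)" if i: "i \<in> {1..n}"
        proof -
          have "(\<Sum>j\<in>{1..n}. real j * lookup_vec x (\<beta> (i, j))) = (\<Sum>j\<in>{1..n}. if j = \<sigma> i then real j else 0)"
            by (rule sum.cong) (use x i in simp_all)
          then show ?thesis using s_in[OF i] by simp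
        qed
        then show "lookup_vec (permvec n \<sigma>) i = lookup_vec (birkhoff_map n \<beta> x) i"
          by (simp add: lookup_permvec lookup_birkhoff_map)
      qed
      ultimately show "permvec n \<sigma> \<in> birkhoff_map n \<beta> ` solutions m (birkhoff_ineqs n \<beta>)" by blast
    qed
  qed
qed

lemma xc_permutahedron_le: "xc (permutahedron n) \<le> n * n + 4 * n"
proof -
  define m where "m = n * n"
  have "card ({1..n} \<times> {1..n}) = card {1..m}" unfolding m_def by simp
  then obtain \<beta> where \<beta>: "bij_betw \<beta> ({1..n} \<times> {1..n}) {1..m}"
    using finite_same_card_bij[of "{1..n} \<times> {1..n}" "{1..m}"] by auto
  define Q where "Q = solutions m (birkhoff_ineqs n \<beta>)"
  have image: "birkhoff_map n \<beta> ` Q = permutahedron n" unfolding Q_def by (rule birkhoff_map_image[OF \<beta>])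
  have in_range: "\<beta> (i, j) \<in> {1..m}" if "i \<in> {1..n}" "j \<in> {1..n}" for i j
    using bij_betwE[OF \<beta>] that by blast
  have "birkhoff_ineqs n \<beta> \<subseteq> Rn m \<times> UNIV"
  proof -
    have vec: "(charvec S, b) \<in> Rn m \<times> UNIV" "(- charvec S, b) \<in> Rn m \<times> UNIV"
      if "S \<subseteq> {1..m}" for S and b :: real
      using charvec_in_Rn[OF that] subspace_neg[OF subspace_Rn] by auto
    have entry: "{\<beta> ij} \<subseteq> {1..m}" if "ij \<in> {1..n} \<times> {1..n}" for ij
      using bij_betwE[OF \<beta>] that by blast
    have row: "(\<lambda>j. \<beta> (i, j)) ` {1..n} \<subseteq> {1..m}" if "i \<in> {1..n}" for i
      using in_range[OF that] by blast
    have col: "(\<lambda>i. \<beta> (i, j)) ` {1..n} \<subseteq> {1..m}" if "j \<in> {1..n}" for j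
      using in_range[OF _ that] by blast
    show ?thesis
      unfolding birkhoff_ineqs_def Un_subset_iff
      by (intro conjI image_subsetI vec(1)[OF row] vec(2)[OF row] vec(1)[OF col] vec(2)[OF col]
          vec(2)[OF entry]; assumption)
  qed
  moreover have "Q \<noteq> {}" using image permvec_in_permutahedron[OF permutes_id] by blast
  ultimately have "polyhedron_in m Q"
    unfolding Q_def using finite_birkhoff_ineqs by (intro polyhedron_in_solutions)
  moreover have "affine_map (birkhoff_map n \<beta>)"
    unfolding affine_map_def using linear_birkhoff_map by (intro exI[of _ "birkhoff_map n \<beta>"] exI[of _ 0]) auto
  ultimately have "xc (permutahedron n) \<le> num_facets Q"
    unfolding xc_def using image by (intro Least_le) blast
  also have "\<dots> \<le> card (birkhoff_ineqs n \<beta>)"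
    unfolding Q_def by (rule num_facets_le[OF finite_birkhoff_ineqs])
  also have "\<dots> \<le> n * n + 4 * n" by (rule card_birkhoff_ineqs)
  finally show ?thesis .
qed

section \<open>Factorizations from extensions\<close>

text \<open>The identity presents \<open>P\<close> as its own extension, so \<open>LEAST\<close>
  ranges over a nonempty set.\<close>

lemma xc_attained:
  assumes "polyhedron_in n P"
  shows "\<exists>m Q \<pi>. polyhedron_in m Q \<and> affine_map \<pi> \<and> \<pi> ` Q = P \<and> xc P = num_facets Q"
proof -
  have "affine_map (\<lambda>x. x)"
    unfolding affine_map_def by (intro exI[of _ "\<lambda>x. x"] exI[of _ 0]) (auto simp: linear_iff)
  then have "\<exists>k m Q \<pi>. polyhedron_in m Q \<and> affine_map \<pi> \<and> \<pi> ` Q = P \<and> k = num_facets Q"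
    using assms by (intro exI[of _ "num_facets P"] exI[of _ n] exI[of _ P] exI[of _ "\<lambda>x. x"]) auto
  from LeastI_ex[OF this] show ?thesis unfolding xc_def .
qed

text \<open>For each \<open>S\<close> one point \<open>x\<close> tight for \<open>S\<close> is factored; its rescaled slacks in the extension are \<open>y\<close>.\<close>

definition nonneg_factorization ::
  "nat \<Rightarrow> (nat set \<Rightarrow> real) \<Rightarrow> nat \<Rightarrow> real \<Rightarrow> (nat set \<Rightarrow> nat \<Rightarrow> real) \<Rightarrow> bool" where
  "nonneg_factorization n f K C \<Lambda> \<longleftrightarrow>
     (\<forall>T\<subseteq>{1..n}. \<forall>i<K. 0 \<le> \<Lambda> T i \<and> \<Lambda> T i \<le> C) \<and>
     (\<forall>S\<subseteq>{1..n}. \<exists>x y. (\<Sum>i\<in>S. x i) = f S \<and> (\<forall>i<K. 0 \<le> y i \<and> y i \<le> 1) \<and>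
        (\<forall>T\<subseteq>{1..n}. f T = (\<Sum>i\<in>T. x i) + (\<Sum>i<K. \<Lambda> T i * y i)))"

lemma nonneg_factorizationD:
  assumes "nonneg_factorization n f K C \<Lambda>" "T \<subseteq> {1..n}" "i < K"
  shows "0 \<le> \<Lambda> T i" "\<Lambda> T i \<le> C"
  using assms by (simp_all add: nonneg_factorization_def)

text \<open>The direction of Yannakakis' theorem from extensions to factorizations. Each inequality
  of the base polytope, pulled back along \<open>\<pi>\<close>, is by Farkas a nonnegative
  combination of slacks of \<open>Q\<close> plus a constant, and the constant vanishes because the
  inequality is tight somewhere.\<close>

lemma slack_factorization:
  assumes Q: "polyhedron_in m Q" and \<pi>: "affine_map \<pi>" and image: "\<pi> ` Q = base_polytope n f"
    and f: "submodular n f"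
  shows "\<exists>I l (s :: rvec \<times> real \<Rightarrow> rvec \<Rightarrow> real). finite I \<and> card I \<le> num_facets Q \<and>
    (\<forall>T\<subseteq>{1..n}. \<forall>e\<in>I. 0 \<le> l T e) \<and> (\<forall>e\<in>I. \<forall>x\<in>Q. 0 \<le> s e x) \<and>
    (\<forall>T\<subseteq>{1..n}. \<forall>x\<in>Q. f T - (\<Sum>i\<in>T. lookup_vec (\<pi> x) i) = (\<Sum>e\<in>I. l T e * s e x))"
proof -
  obtain L c where L: "linear L" "\<pi> = (\<lambda>x. L x + c)" using \<pi> unfolding affine_map_def by blast
  have "Q \<noteq> {}" using ex_tight_point[OF f, of "{}"] image by auto
  then obtain p where p: "p \<in> Q" by auto
  obtain I where I: "finite I" "card I \<le> num_facets Q"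
    and Q_eq: "Q = {x. x - p \<in> directions Q \<and> (\<forall>(a, b)\<in>I. dot m a x \<le> b)}"
    using polyhedron_facet_description[OF Q p] by blast
  define s where "s e x = snd e - dot m (fst e) x" for e :: "rvec \<times> real" and x
  have QI: "x \<in> Q" if "x - p \<in> directions Q" "\<And>e. e \<in> I \<Longrightarrow> dot m (fst e) x \<le> snd e" for x
  proof -
    have "x \<in> {x. x - p \<in> directions Q \<and> (\<forall>(a, b)\<in>I. dot m a x \<le> b)}" using that by auto
    then show ?thesis using Q_eq by argo
  qed
  have Q_le: "dot m (fst e) x \<le> snd e" if "x \<in> Q" "e \<in> I" for x e
  proof -
    have "x \<in> {x. x - p \<in> directions Q \<and> (\<forall>(a, b)\<in>I. dot m a x \<le> b)}" using Q_eq that(1) by argo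
    then show ?thesis using that(2) by auto
  qed
  have Q_dir: "x - p \<in> directions Q" if "x \<in> Q" for x using that p by (rule directionsI)
  have wt: "(\<Sum>i\<in>T. lookup_vec (\<pi> x) i) = (\<Sum>i\<in>T. lookup_vec (L x) i) + (\<Sum>i\<in>T. lookup_vec c i)" for T x
    unfolding L(2) by (simp add: lookup_add sum.distrib)
  have "\<exists>l. (\<forall>e\<in>I. 0 \<le> l e) \<and>
      (\<forall>x\<in>Q. f T - (\<Sum>i\<in>T. lookup_vec (\<pi> x) i) = (\<Sum>e\<in>I. l e * s e x))" if T: "T \<subseteq> {1..n}" for T
  proof -
    have "\<exists>l l0. (\<forall>e\<in>I. l e \<ge> 0) \<and> l0 \<ge> 0 \<and> (\<forall>x. x - p \<in> directions Q \<longrightarrow>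
        (f T - (\<Sum>i\<in>T. lookup_vec c i)) - (\<Sum>i\<in>T. lookup_vec (L x) i) =
        (\<Sum>e\<in>I. l e * (snd e - dot m (fst e) x)) + l0)"
    proof (rule affine_farkas[OF I(1) subspace_directions])
      show "linear (\<lambda>x. \<Sum>i\<in>T. lookup_vec (L x) i)"
        using L(1) unfolding linear_iff by (auto simp: lookup_add sum.distrib sum_distrib_left)
      fix x assume "x - p \<in> directions Q" "\<And>e. e \<in> I \<Longrightarrow> dot m (fst e) x \<le> snd e"
      then have "\<pi> x \<in> base_polytope n f" using QI image by blast
      then have "(\<Sum>i\<in>T. lookup_vec (\<pi> x) i) \<le> f T" using T unfolding base_polytope_def by blast
      then show "(\<Sum>i\<in>T. lookup_vec (L x) i) \<le> f T - (\<Sum>i\<in>T. lookup_vec c i)" using wt[where T = T and x = x] by linarith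
    qed (use linear_dot Q_le p in auto)
    then obtain l l0 where l: "\<forall>e\<in>I. l e \<ge> 0" "l0 \<ge> 0"
      and eq: "\<And>x. x \<in> Q \<Longrightarrow> f T - (\<Sum>i\<in>T. lookup_vec (\<pi> x) i) = (\<Sum>e\<in>I. l e * s e x) + l0"
      unfolding s_def wt using Q_dir by (smt (verit))
    obtain y where "y \<in> base_polytope n f" "(\<Sum>i\<in>T. lookup_vec y i) = f T"
      using ex_tight_point[OF f T] by blast
    then obtain x where x: "x \<in> Q" "(\<Sum>i\<in>T. lookup_vec (\<pi> x) i) = f T" using image by (metis imageE)
    have "(\<Sum>e\<in>I. l e * s e x) \<ge> 0"
      by (rule sum_nonneg) (use l(1) Q_le[OF x(1)] in \<open>auto simp: s_def\<close>)
    then have "l0 = 0" using eq[OF x(1)] x(2) l(2) by linarith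
    then show ?thesis using l(1) eq by auto
  qed
  then obtain l where l: "\<And>T. T \<subseteq> {1..n} \<Longrightarrow> (\<forall>e\<in>I. 0 \<le> l T e) \<and>
      (\<forall>x\<in>Q. f T - (\<Sum>i\<in>T. lookup_vec (\<pi> x) i) = (\<Sum>e\<in>I. l T e * s e x))"
    by metis
  moreover have "\<forall>e\<in>I. \<forall>x\<in>Q. 0 \<le> s e x" using Q_le unfolding s_def by simp
  ultimately show ?thesis using I by (intro exI[of _ I] exI[of _ l] exI[of _ s]) blast
qed

text \<open>Rescaling every slack so that its maximum over the lifts of finitely many tight points is
  \<open>1\<close> bounds the multipliers by the slacks of the polytope itself.\<close>

lemma ex_nonneg_factorization:
  assumes f: "submodular n f" and K: "xc (base_polytope n f) \<le> K"
    and C: "\<And>T. T \<subseteq> {1..n} \<Longrightarrow> f T + f ({1..n} - T) - f {1..n} \<le> C"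
  shows "\<exists>\<Lambda>. nonneg_factorization n f K C \<Lambda>"
proof -
  have "polyhedron_in n (base_polytope n f)"
    using polytope_in_base_polytope ex_tight_point[OF f, of "{}"] unfolding polytope_in_def by blast
  then obtain m Q \<pi> where Q: "polyhedron_in m Q" "affine_map \<pi>" "\<pi> ` Q = base_polytope n f"
    "xc (base_polytope n f) = num_facets Q"
    using xc_attained by blast
  obtain I l and s :: "rvec \<times> real \<Rightarrow> rvec \<Rightarrow> real" where I: "finite I" "card I \<le> num_facets Q"
    and l': "\<forall>T\<subseteq>{1..n}. \<forall>e\<in>I. 0 \<le> l T e" and s': "\<forall>e\<in>I. \<forall>x\<in>Q. 0 \<le> s e x"
    and eq': "\<forall>T\<subseteq>{1..n}. \<forall>x\<in>Q.
      f T - (\<Sum>i\<in>T. lookup_vec (\<pi> x) i) = (\<Sum>e\<in>I. l T e * s e x)"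
    using slack_factorization[OF Q(1-3) f] by (elim exE conjE)
  note l = l'[rule_format] and s = s'[rule_format] and eq = eq'[rule_format]
  have "\<exists>x\<in>Q. (\<Sum>i\<in>S. lookup_vec (\<pi> x) i) = f S" if "S \<subseteq> {1..n}" for S
    using ex_tight_point[OF f that] Q(3) by (metis imageE)
  then obtain q where q: "\<And>S. S \<subseteq> {1..n} \<Longrightarrow> q S \<in> Q"
    "\<And>S. S \<subseteq> {1..n} \<Longrightarrow> (\<Sum>i\<in>S. lookup_vec (\<pi> (q S)) i) = f S"
    by metis
  define M where "M e = Max ((\<lambda>S. s e (q S)) ` Pow {1..n})" for e
  have M_ge: "s e (q S) \<le> M e" if "S \<subseteq> {1..n}" for e S
    unfolding M_def using that by (intro Max_ge) auto
  have M_attained: "\<exists>S\<subseteq>{1..n}. M e = s e (q S)" for e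
  proof -
    have "M e \<in> (\<lambda>S. s e (q S)) ` Pow {1..n}" unfolding M_def by (intro Max_in) auto
    then show ?thesis by blast
  qed
  obtain h where h: "bij_betw h {0..<card I} I" using ex_bij_betw_nat_finite[OF I(1)] by blast
  have cK: "card I \<le> K" using I(2) K Q(4) by simp
  have hI: "h i \<in> I" if "i < card I" for i using bij_betwE[OF h] that by auto
  \<comment> \<open>Moving the factor \<open>M\<close> from the slacks to the multipliers keeps the
    products. Indices from \<open>card I\<close> up to \<open>K\<close> are padded with 0.\<close>
  define \<Lambda> where "\<Lambda> T i = (if i < card I then l T (h i) * M (h i) else 0)" for T i
  define y where "y S i = (if i < card I then s (h i) (q S) / M (h i) else 0)" for S i
  have \<Lambda>: "0 \<le> \<Lambda> T i \<and> \<Lambda> T i \<le> C" if T: "T \<subseteq> {1..n}" for T i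
  proof (cases "i < card I")
    case True
    obtain S where S: "S \<subseteq> {1..n}" "M (h i) = s (h i) (q S)" using M_attained by blast
    have nn: "0 \<le> l T e * s e (q S)" if "e \<in> I" for e
      using l[OF T that] s[OF that q(1)[OF S(1)]] by simp
    \<comment> \<open>At the point where slack \<open>h i\<close> attains its maximum, the rescaled
      multiplier is a single term of the slack sum for \<open>T\<close>.\<close>
    have "\<Lambda> T i = l T (h i) * s (h i) (q S)" unfolding \<Lambda>_def using True S(2) by simp
    also have "\<dots> \<le> (\<Sum>e\<in>I. l T e * s e (q S))"
      by (rule member_le_sum) (use hI[OF True] nn I(1) in auto)
    also have "\<dots> = f T - (\<Sum>i\<in>T. lookup_vec (\<pi> (q S)) i)" using eq[OF T q(1)[OF S(1)]] by simp
    also have "\<dots> \<le> C"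
      using base_polytope_slack_le[of "\<pi> (q S)" n f T] C[OF T] q(1)[OF S(1)] Q(3) T by fastforce
    finally have "\<Lambda> T i \<le> C" .
    moreover have "\<Lambda> T i \<ge> 0"
      using \<open>\<Lambda> T i = l T (h i) * s (h i) (q S)\<close> nn[OF hI[OF True]] by simp
    ultimately show ?thesis by simp
  next
    case False
    \<comment> \<open>A padded entry 0 also needs \<open>0 \<le> C\<close>, which the vanishing
      slack at the tight point of \<open>T\<close> provides.\<close>
    have "0 \<le> f T - (\<Sum>i\<in>T. lookup_vec (\<pi> (q T)) i)" using q(2)[OF T] by simp
    also have "\<dots> \<le> C"
      using base_polytope_slack_le[of "\<pi> (q T)" n f T] C[OF T] q(1)[OF T] Q(3) T by fastforce
    finally show ?thesis using False unfolding \<Lambda>_def by simp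
  qed
  have y1: "0 \<le> y S i \<and> y S i \<le> 1" if S: "S \<subseteq> {1..n}" for S i
  proof (cases "i < card I")
    case True
    have "0 \<le> s (h i) (q S)" "s (h i) (q S) \<le> M (h i)"
      using s[OF hI[OF True] q(1)[OF S]] M_ge[OF S] by auto
    then show ?thesis unfolding y_def using True by (auto simp: divide_le_eq_1)
  qed (simp add: y_def)
  have fac: "f T = (\<Sum>i\<in>T. lookup_vec (\<pi> (q S)) i) + (\<Sum>i<K. \<Lambda> T i * y S i)"
    if S: "S \<subseteq> {1..n}" and T: "T \<subseteq> {1..n}" for S T
  proof -
    have "(\<Sum>i<K. \<Lambda> T i * y S i) = (\<Sum>i\<in>{0..<card I}. \<Lambda> T i * y S i)"
      by (rule sum.mono_neutral_right) (use cK in \<open>auto simp: \<Lambda>_def\<close>)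
    also have "\<dots> = (\<Sum>i\<in>{0..<card I}. l T (h i) * s (h i) (q S))"
    proof (rule sum.cong[OF refl])
      fix i assume i: "i \<in> {0..<card I}"
      then have "i < card I" by simp
      have "0 \<le> s (h i) (q S)" "s (h i) (q S) \<le> M (h i)"
        using s[OF hI q(1)[OF S]] M_ge[OF S] \<open>i < card I\<close> by auto
      \<comment> \<open>If the maximum is 0, the slack vanishes at all chosen points, so the
        division by zero in \<open>y\<close> does no harm.\<close>
      then have "M (h i) = 0 \<Longrightarrow> s (h i) (q S) = 0" by simp
      then show "\<Lambda> T i * y S i = l T (h i) * s (h i) (q S)"
        using \<open>i < card I\<close> unfolding \<Lambda>_def y_def by (cases "M (h i) = 0") simp_all
    qed
    also have "\<dots> = (\<Sum>e\<in>I. l T e * s e (q S))"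
      by (rule sum.reindex_bij_betw[OF h, of "\<lambda>e. l T e * s e (q S)"])
    finally show ?thesis using eq[OF T q(1)[OF S]] by simp
  qed
  have "nonneg_factorization n f K C \<Lambda>"
    unfolding nonneg_factorization_def
  proof (intro conjI allI impI)
    fix S assume S: "S \<subseteq> {1..n}"
    show "\<exists>x y. (\<Sum>i\<in>S. x i) = f S \<and> (\<forall>i<K. 0 \<le> y i \<and> y i \<le> 1) \<and>
        (\<forall>T\<subseteq>{1..n}. f T = (\<Sum>i\<in>T. x i) + (\<Sum>i<K. \<Lambda> T i * y i))"
      by (intro exI[of _ "lookup_vec (\<pi> (q S))"] exI[of _ "y S"] conjI allI impI
          q(2)[OF S] fac[OF S] conjunct1[OF y1[OF S]] conjunct2[OF y1[OF S]])
  qed (simp_all add: \<Lambda>)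
  then show ?thesis by blast
qed

text \<open>The rows are the vectors consisting of the indicator of \<open>T\<close>, of \<open>\<Lambda> T\<close> and of \<open>f T\<close>.\<close>

definition spanning_rows ::
  "nat \<Rightarrow> (nat set \<Rightarrow> real) \<Rightarrow> nat \<Rightarrow> (nat set \<Rightarrow> nat \<Rightarrow> real) \<Rightarrow> nat \<Rightarrow> (nat \<Rightarrow> nat set) \<Rightarrow> bool" where
  "spanning_rows n f K \<Lambda> D e \<longleftrightarrow> (\<forall>T\<subseteq>{1..n}. \<exists>c.
     (\<forall>i\<in>{1..n}. of_bool (i \<in> T) = (\<Sum>j<D. c j * of_bool (i \<in> e j))) \<and>
     (\<forall>i<K. \<Lambda> T i = (\<Sum>j<D. c j * \<Lambda> (e j) i)) \<and> f T = (\<Sum>j<D. c j * f (e j)) \<and>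
     (\<Sum>j<D. \<bar>c j\<bar>) \<le> 2 ^ D)"

lemma ex_spanning_rows:
  assumes "D = n + K + 1"
  shows "\<exists>e. (\<forall>j<D. e j \<subseteq> {1..n}) \<and> spanning_rows n f K \<Lambda> D e"
proof -
  \<comment> \<open>The \<open>n + K + 1\<close> columns hold the indicator, the multipliers and the
    value. Column \<open>i < n\<close> stands for the element \<open>Suc i\<close>, since the ground
    set starts at 1.\<close>
  define row where "row T i = (if i < n then of_bool (Suc i \<in> T)
    else if i < n + K then \<Lambda> T (i - n) else f T)" for T i
  obtain e where e: "\<forall>j<D. e j \<in> Pow {1..n}"
    and span: "\<forall>T\<in>Pow {1..n}. \<exists>c. (\<forall>i<D. row T i = (\<Sum>j<D. c j * row (e j) i)) \<and>
      (\<Sum>j<D. \<bar>c j\<bar>) \<le> 2 ^ D - 1"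
    using bounded_spanner[OF finite_Pow_iff[THEN iffD2, OF finite_atLeastAtMost] Pow_not_empty, of D 1 n row]
    by (elim exE conjE)
  have "spanning_rows n f K \<Lambda> D e"
    unfolding spanning_rows_def
  proof (intro allI impI)
    fix T assume "T \<subseteq> {1..n}"
    then have "T \<in> Pow {1..n}" by simp
    from span[rule_format, OF this]
    obtain c where c': "\<forall>i<D. row T i = (\<Sum>j<D. c j * row (e j) i)"
      and c_sum: "(\<Sum>j<D. \<bar>c j\<bar>) \<le> 2 ^ D - 1" by (elim exE conjE)
    note c = c'[rule_format] c_sum
    have "of_bool (i \<in> T) = (\<Sum>j<D. c j * of_bool (i \<in> e j))" if "i \<in> {1..n}" for i
    proof -
      have "row S (i - 1) = of_bool (i \<in> S)" for S
        using that unfolding row_def by (cases i) auto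
      moreover have "i - 1 < D" using that assms by auto
      ultimately show ?thesis using c(1)[of "i - 1"] by (simp only:)
    qed
    moreover have "\<Lambda> T i = (\<Sum>j<D. c j * \<Lambda> (e j) i)" if "i < K" for i
    proof -
      have "row S (n + i) = \<Lambda> S i" for S using that unfolding row_def by simp
      then show ?thesis using c(1)[of "n + i"] that assms by simp
    qed
    moreover have "f T = (\<Sum>j<D. c j * f (e j))"
    proof -
      have "row S (n + K) = f S" for S unfolding row_def by simp
      then show ?thesis using c(1)[of "n + K"] assms by simp
    qed
    moreover have "(\<Sum>j<D. \<bar>c j\<bar>) \<le> 2 ^ D" using c(2) by simp
    ultimately show "\<exists>c. (\<forall>i\<in>{1..n}. of_bool (i \<in> T) = (\<Sum>j<D. c j * of_bool (i \<in> e j))) \<and>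
      (\<forall>i<K. \<Lambda> T i = (\<Sum>j<D. c j * \<Lambda> (e j) i)) \<and> f T = (\<Sum>j<D. c j * f (e j)) \<and>
      (\<Sum>j<D. \<bar>c j\<bar>) \<le> 2 ^ D" by blast
  qed
  then show ?thesis using e by blast
qed

text \<open>The residual \<open>r\<close> pairs the point and slack vector that \<open>f\<close> has
  for \<open>T\<close> with the multipliers and values of \<open>f'\<close>. It is linear in the
  rows of \<open>f'\<close>, and on the spanning rows, where \<open>f = f'\<close> and the
  multipliers nearly agree, it is at most \<open>real K * \<epsilon>\<close>; hence it is small at
  \<open>T\<close>. As the point is tight for \<open>f\<close> at \<open>T\<close>, dropping the
  nonnegative slack term leaves a one-sided estimate.\<close>

lemma factorization_stable:
  assumes fac: "nonneg_factorization n f K C \<Lambda>" and fac': "nonneg_factorization n f' K C \<Lambda>'"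
    and span: "spanning_rows n f' K \<Lambda>' D e" and e: "\<And>j. j < D \<Longrightarrow> e j \<subseteq> {1..n}"
    and ff: "\<And>j. j < D \<Longrightarrow> f (e j) = f' (e j)"
    and close: "\<And>j i. j < D \<Longrightarrow> i < K \<Longrightarrow> \<bar>\<Lambda>' (e j) i - \<Lambda> (e j) i\<bar> \<le> \<epsilon>"
    and "0 \<le> \<epsilon>" and T: "T \<subseteq> {1..n}"
  shows "f T \<le> f' T + 2 ^ D * (real K * \<epsilon>)"
proof -
  obtain x y where x: "(\<Sum>i\<in>T. x i) = f T" and y: "\<And>i. i < K \<Longrightarrow> 0 \<le> y i \<and> y i \<le> 1"
    and eq: "\<And>S. S \<subseteq> {1..n} \<Longrightarrow> f S = (\<Sum>i\<in>S. x i) + (\<Sum>i<K. \<Lambda> S i * y i)"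
    using fac T unfolding nonneg_factorization_def by blast
  obtain c where c1': "\<forall>i\<in>{1..n}. of_bool (i \<in> T) = (\<Sum>j<D. c j * of_bool (i \<in> e j))"
    and c2': "\<forall>i<K. \<Lambda>' T i = (\<Sum>j<D. c j * \<Lambda>' (e j) i)"
    and c3: "f' T = (\<Sum>j<D. c j * f' (e j))" and c4: "(\<Sum>j<D. \<bar>c j\<bar>) \<le> 2 ^ D"
    using span[unfolded spanning_rows_def, rule_format, OF T] by (elim exE conjE)
  note c1 = c1'[rule_format] and c2 = c2'[rule_format]
  have restrict: "(\<Sum>i\<in>S. x i) = (\<Sum>i\<in>{1..n}. of_bool (i \<in> S) * x i)" if "S \<subseteq> {1..n}" for S
  proof -
    have "(\<Sum>i\<in>{1..n}. of_bool (i \<in> S) * x i) = (\<Sum>i\<in>{1..n}. if i \<in> S then x i else 0)"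
      by (rule sum.cong) auto
    then show ?thesis
      using sum.inter_restrict[of "{1..n}" x S] that by (simp add: Int_absorb1)
  qed
  have exchange: "(\<Sum>i\<in>A. (\<Sum>j<D. c j * g j i) * z i) = (\<Sum>j<D. c j * (\<Sum>i\<in>A. g j i * z i))"
    for A :: "nat set" and g :: "nat \<Rightarrow> nat \<Rightarrow> real" and z :: "nat \<Rightarrow> real"
  proof -
    have "(\<Sum>i\<in>A. (\<Sum>j<D. c j * g j i) * z i) = (\<Sum>i\<in>A. \<Sum>j<D. c j * (g j i * z i))"
      by (simp only: sum_distrib_right mult.assoc)
    also have "\<dots> = (\<Sum>j<D. \<Sum>i\<in>A. c j * (g j i * z i))" by (rule sum.swap)
    finally show ?thesis by (simp only: sum_distrib_left)
  qed
  define r where "r S = (\<Sum>i\<in>S. x i) + (\<Sum>i<K. \<Lambda>' S i * y i) - f' S" for S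
  have "r T = (\<Sum>j<D. c j * r (e j))"
  proof -
    have "(\<Sum>i\<in>T. x i) = (\<Sum>i\<in>{1..n}. (\<Sum>j<D. c j * of_bool (i \<in> e j)) * x i)"
      unfolding restrict[OF T]
      by (intro sum.cong[OF refl] arg_cong2[where f = "(*)"] refl c1)
    also have "\<dots> = (\<Sum>j<D. c j * (\<Sum>i\<in>{1..n}. of_bool (i \<in> e j) * x i))"
      by (rule exchange)
    also have "\<dots> = (\<Sum>j<D. c j * (\<Sum>i\<in>e j. x i))"
      by (intro sum.cong[OF refl] arg_cong2[where f = "(*)"] refl restrict[OF e, symmetric]) simp
    finally have 1: "(\<Sum>i\<in>T. x i) = (\<Sum>j<D. c j * (\<Sum>i\<in>e j. x i))" .
    have "(\<Sum>i<K. \<Lambda>' T i * y i) = (\<Sum>i<K. (\<Sum>j<D. c j * \<Lambda>' (e j) i) * y i)"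
      by (rule sum.cong) (use c2 in simp_all)
    also have "\<dots> = (\<Sum>j<D. c j * (\<Sum>i<K. \<Lambda>' (e j) i * y i))"
      by (rule exchange)
    finally have 2: "(\<Sum>i<K. \<Lambda>' T i * y i) = (\<Sum>j<D. c j * (\<Sum>i<K. \<Lambda>' (e j) i * y i))" .
    show ?thesis unfolding r_def 1 2 c3 by (simp add: algebra_simps sum.distrib sum_subtractf)
  qed
  moreover have "\<bar>r (e j)\<bar> \<le> real K * \<epsilon>" if j: "j < D" for j
  proof -
    have "r (e j) = (\<Sum>i<K. (\<Lambda>' (e j) i - \<Lambda> (e j) i) * y i)"
      unfolding r_def ff[OF j, symmetric] eq[OF e[OF j]]
      by (simp add: left_diff_distrib sum_subtractf)
    also have "\<bar>\<dots>\<bar> \<le> (\<Sum>i<K. \<bar>(\<Lambda>' (e j) i - \<Lambda> (e j) i) * y i\<bar>)" by (rule sum_abs)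
    also have "\<dots> \<le> (\<Sum>i<K. \<epsilon>)"
    proof (rule sum_mono)
      fix i assume "i \<in> {..<K}"
      then have i: "i < K" by simp
      have "\<bar>\<Lambda>' (e j) i - \<Lambda> (e j) i\<bar> * \<bar>y i\<bar> \<le> \<epsilon> * 1"
        using close[OF j i] y[OF i] by (intro mult_mono) auto
      then show "\<bar>(\<Lambda>' (e j) i - \<Lambda> (e j) i) * y i\<bar> \<le> \<epsilon>" by (simp add: abs_mult)
    qed
    finally show ?thesis by simp
  qed
  moreover have "\<bar>\<Sum>j<D. c j * r (e j)\<bar> \<le> 2 ^ D * (real K * \<epsilon>)" if r: "\<And>j. j < D \<Longrightarrow> \<bar>r (e j)\<bar> \<le> real K * \<epsilon>"
  proof -
    have nn: "0 \<le> real K * \<epsilon>" using \<open>0 \<le> \<epsilon>\<close> by simp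
    have "\<bar>\<Sum>j<D. c j * r (e j)\<bar> \<le> (\<Sum>j<D. \<bar>c j\<bar> * (real K * \<epsilon>))"
      by (rule order_trans[OF sum_abs], rule sum_mono) (use r in \<open>auto simp: abs_mult intro: mult_left_mono\<close>)
    also have "\<dots> = (\<Sum>j<D. \<bar>c j\<bar>) * (real K * \<epsilon>)" by (simp add: sum_distrib_right)
    also have "\<dots> \<le> 2 ^ D * (real K * \<epsilon>)" using c4 nn by (rule mult_right_mono)
    finally show ?thesis .
  qed
  moreover have "0 \<le> (\<Sum>i<K. \<Lambda>' T i * y i)"
    using fac' T y unfolding nonneg_factorization_def by (intro sum_nonneg mult_nonneg_nonneg) auto
  ultimately show ?thesis using x unfolding r_def by (smt (verit))
qed

section \<open>Counting\<close>

text \<open>Membership of \<open>T\<close> in \<open>A\<close> changes the value by 1/4, the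
  threshold for the accumulated rounding error.\<close>

definition set_function :: "nat \<Rightarrow> nat set set \<Rightarrow> nat set \<Rightarrow> real" where
  "set_function n A T = (top_sum n (card T) + of_bool (T \<in> A) / 2) / 2"

lemma submodular_set_function: "{} \<notin> A \<Longrightarrow> submodular n (set_function n A)"
  unfolding set_function_def by (rule submodular_perturbed) auto

lemma summand_of_permutahedron:
  assumes "{} \<notin> A"
  shows "minkowski_summand_in n (base_polytope n (set_function n A)) (permutahedron n)"
proof -
  let ?f = "set_function n A" and ?g = "\<lambda>T. (top_sum n (card T) + - (of_bool (T \<in> A) / 2)) / 2"
  have f: "submodular n ?f" by (rule submodular_set_function[OF assms])
  have g: "submodular n ?g" by (rule submodular_perturbed) (use assms in auto)
  have "minkowski_sum (base_polytope n ?f) (base_polytope n ?g) = permutahedron n"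
    by (rule minkowski_sum_base_polytopes[OF f g]) (simp add: set_function_def field_simps)
  moreover have "polytope_in n (base_polytope n h)" if "submodular n h" for h
    using ex_tight_point[OF that, of "{}"] by (intro polytope_in_base_polytope) auto
  ultimately show ?thesis unfolding minkowski_summand_in_def using f g by blast
qed

text \<open>For \<open>t = card T\<close> the contribution of \<open>top_sum\<close> is half of
  \<open>t * (n - t)\<close>. The bound is crude but integral, which later makes the number of grid
  steps an integer.\<close>

lemma set_function_slack_le:
  assumes "T \<subseteq> {1..n}"
  shows "set_function n A T + set_function n A ({1..n} - T) - set_function n A {1..n} \<le> real (n * n + 1)"
proof -
  have fin: "finite T" and t: "card T \<le> n" using assms finite_subset card_mono[OF _ assms] by auto
  have c: "card ({1..n} - T) = n - card T" using card_Diff_subset[OF fin assms] by simp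
  have "top_sum n (card T) + top_sum n (n - card T) - top_sum n n = real (card T) * (real n - real (card T))"
    using t unfolding top_sum_def by (simp add: of_nat_diff field_simps)
  also have "\<dots> \<le> real n * real n" using t by (intro mult_mono) auto
  finally have top: "top_sum n (card T) + top_sum n (n - card T) - top_sum n n \<le> real n * real n" .
  have bound: "(x + p / 2) / 2 + (y + q / 2) / 2 - (z + r / 2) / 2 \<le> m + 1"
    if "x + y - z \<le> m" "0 \<le> m" "p \<le> 1" "q \<le> 1" "0 \<le> r" for x y z p q r m :: real
    using that by (simp add: field_simps)
  have "(top_sum n (card T) + of_bool (T \<in> A) / 2) / 2 +
      (top_sum n (n - card T) + of_bool ({1..n} - T \<in> A) / 2) / 2 -
      (top_sum n n + of_bool ({1..n} \<in> A) / 2) / 2 \<le> real n * real n + 1"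
    by (rule bound[OF top]) auto
  then show ?thesis unfolding set_function_def c by simp
qed

section \<open>Rounding and encoding\<close>

lemma floor_close:
  fixes a b \<epsilon> :: real
  assumes "0 < \<epsilon>" "0 \<le> a" "0 \<le> b" "nat \<lfloor>a / \<epsilon>\<rfloor> = nat \<lfloor>b / \<epsilon>\<rfloor>"
  shows "\<bar>a - b\<bar> \<le> \<epsilon>"
proof -
  have "0 \<le> \<lfloor>a / \<epsilon>\<rfloor>" "0 \<le> \<lfloor>b / \<epsilon>\<rfloor>" using assms(1-3) by auto
  then have "\<lfloor>a / \<epsilon>\<rfloor> = \<lfloor>b / \<epsilon>\<rfloor>" using assms(4) by (simp add: nat_eq_iff)
  then have "\<bar>a / \<epsilon> - b / \<epsilon>\<bar> \<le> 1" by linarith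
  then have "\<bar>a - b\<bar> / \<epsilon> \<le> 1" using assms(1) by (simp add: diff_divide_distrib[symmetric])
  then show ?thesis using assms(1) by (simp add: divide_le_eq)
qed

text \<open>The bit \<open>e j \<in> A\<close> fixes the value of the set function on
  \<open>e j\<close>; real entries survive only as grid cells. The restrictions make the codes
  elements of a finite product.\<close>

definition factorization_code ::
  "nat \<Rightarrow> nat \<Rightarrow> real \<Rightarrow> nat set set \<Rightarrow> (nat set \<Rightarrow> nat \<Rightarrow> real) \<Rightarrow> (nat \<Rightarrow> nat set) \<Rightarrow>
    nat \<Rightarrow> nat set \<times> bool \<times> (nat \<Rightarrow> nat)" where
  "factorization_code D K \<epsilon> A \<Lambda> e = restrict (\<lambda>j. (e j, e j \<in> A, restrict (\<lambda>i. nat \<lfloor>\<Lambda> (e j) i / \<epsilon>\<rfloor>) {..<K})) {..<D}"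

text \<open>Equal codes give the same spanning sets, the same values there and multipliers within
  \<open>\<epsilon>\<close>. Were \<open>T\<close> in \<open>A\<close> only, the two values at
  \<open>T\<close> would differ by 1/4, more than the error allows. Exchanging the families gives
  the other inclusion.\<close>

lemma factorization_code_le:
  assumes fac: "nonneg_factorization n (set_function n A) K C \<Lambda>"
    and fac': "nonneg_factorization n (set_function n A') K C \<Lambda>'"
    and span: "spanning_rows n (set_function n A') K \<Lambda>' D e'"
    and e: "\<And>j. j < D \<Longrightarrow> e' j \<subseteq> {1..n}"
    and \<epsilon>: "0 < \<epsilon>" "2 ^ D * (real K * \<epsilon>) < 1 / 4"
    and code: "factorization_code D K \<epsilon> A \<Lambda> e = factorization_code D K \<epsilon> A' \<Lambda>' e'"
    and T: "T \<subseteq> {1..n}" "T \<in> A"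
  shows "T \<in> A'"
proof -
  have at: "e j = e' j \<and> (e j \<in> A \<longleftrightarrow> e' j \<in> A') \<and>
      restrict (\<lambda>i. nat \<lfloor>\<Lambda> (e j) i / \<epsilon>\<rfloor>) {..<K} = restrict (\<lambda>i. nat \<lfloor>\<Lambda>' (e' j) i / \<epsilon>\<rfloor>) {..<K}"
    if "j < D" for j
  proof -
    have at_j: "factorization_code D K \<epsilon> B M g j = (g j, g j \<in> B, restrict (\<lambda>i. nat \<lfloor>M (g j) i / \<epsilon>\<rfloor>) {..<K})" for B M g
      using that unfolding factorization_code_def by simp
    from fun_cong[OF code, of j] show ?thesis unfolding at_j prod.inject .
  qed
  have "set_function n A T \<le> set_function n A' T + 2 ^ D * (real K * \<epsilon>)"
  proof (rule factorization_stable[OF fac fac' span e])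
    show "set_function n A (e' j) = set_function n A' (e' j)" if "j < D" for j
    proof -
      have "e' j \<in> A \<longleftrightarrow> e' j \<in> A'" using at[OF that] by metis
      then show ?thesis unfolding set_function_def by simp
    qed
    show "\<bar>\<Lambda>' (e' j) i - \<Lambda> (e' j) i\<bar> \<le> \<epsilon>" if j: "j < D" and i: "i < K" for j i
    proof (rule floor_close[OF \<epsilon>(1)])
      show "0 \<le> \<Lambda>' (e' j) i" "0 \<le> \<Lambda> (e' j) i"
        using nonneg_factorizationD(1)[OF fac' e[OF j] i] nonneg_factorizationD(1)[OF fac e[OF j] i] .
      have "restrict (\<lambda>i. nat \<lfloor>\<Lambda> (e' j) i / \<epsilon>\<rfloor>) {..<K} i = restrict (\<lambda>i. nat \<lfloor>\<Lambda>' (e' j) i / \<epsilon>\<rfloor>) {..<K} i"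
        using at[OF j] by metis
      then show "nat \<lfloor>\<Lambda>' (e' j) i / \<epsilon>\<rfloor> = nat \<lfloor>\<Lambda> (e' j) i / \<epsilon>\<rfloor>" using i by simp
    qed
  qed (use \<epsilon> T in auto)
  then have "(of_bool (T \<in> A) - of_bool (T \<in> A')) / 4 < (1 / 4 :: real)"
    using \<epsilon>(2) unfolding set_function_def by argo
  then show ?thesis using T(2) by (cases "T \<in> A'") auto
qed

lemma code_count:
  assumes D: "D = n + K + 1"
    and small: "\<And>A. A \<subseteq> Pow {1..n} - {{}} \<Longrightarrow> xc (base_polytope n (set_function n A)) \<le> K"
  defines "N \<equiv> (n * n + 1) * (4 * (K + 1) * 2 ^ D)"
  shows "(2::nat) ^ (2 ^ n - 1) \<le> (2 ^ n * (2 * (N + 1) ^ K)) ^ D"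
proof -
  define C where "C = real (n * n + 1)"
  \<comment> \<open>An error \<open>real K * \<epsilon>\<close> per row, amplified by
    \<open>2 ^ D\<close>, stays below 1/4; \<open>K + 1\<close> in place of \<open>K\<close> makes
    this strict and covers \<open>K = 0\<close>.\<close>
  define \<epsilon> where "\<epsilon> = 1 / real (4 * (K + 1) * 2 ^ D)"
  have \<epsilon>: "0 < \<epsilon>" "2 ^ D * (real K * \<epsilon>) < 1 / 4"
  proof -
    show "0 < \<epsilon>" unfolding \<epsilon>_def by simp
    have "2 ^ D * (real K * \<epsilon>) = real K / (4 * (real K + 1))"
      unfolding \<epsilon>_def of_nat_mult of_nat_power of_nat_add by simp
    also have "\<dots> < 1 / 4" by (simp add: field_simps)
    finally show "2 ^ D * (real K * \<epsilon>) < 1 / 4" .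
  qed
  define \<A> where "\<A> = Pow (Pow {1..n} - {{}::nat set})"
  have "\<exists>\<Lambda>. nonneg_factorization n (set_function n A) K C \<Lambda>" if "A \<in> \<A>" for A
    unfolding C_def
  proof (rule ex_nonneg_factorization)
    show "submodular n (set_function n A)"
      using that by (intro submodular_set_function) (auto simp: \<A>_def)
    show "xc (base_polytope n (set_function n A)) \<le> K"
      using that by (intro small) (auto simp: \<A>_def)
  qed (rule set_function_slack_le)
  then obtain \<Lambda> where \<Lambda>: "\<And>A. A \<in> \<A> \<Longrightarrow> nonneg_factorization n (set_function n A) K C (\<Lambda> A)"
    by metis
  have "\<exists>e. (\<forall>j<D. e j \<subseteq> {1..n}) \<and> spanning_rows n (set_function n A) K (\<Lambda> A) D e" for A
    by (rule ex_spanning_rows[OF D])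
  then obtain e where e: "\<And>A j. j < D \<Longrightarrow> e A j \<subseteq> {1..n}"
    and span: "\<And>A. spanning_rows n (set_function n A) K (\<Lambda> A) D (e A)"
    by metis
  define code where "code A = factorization_code D K \<epsilon> A (\<Lambda> A) (e A)" for A
  have "inj_on code \<A>"
  proof (rule inj_onI)
    have le: "A \<subseteq> A'" if "A \<in> \<A>" "A' \<in> \<A>" "code A = code A'" for A A'
    proof
      fix T assume "T \<in> A"
      then show "T \<in> A'"
        using that factorization_code_le[OF \<Lambda>[OF that(1)] \<Lambda>[OF that(2)] span e \<epsilon>]
        unfolding code_def \<A>_def by blast
    qed
    fix A A' assume "A \<in> \<A>" "A' \<in> \<A>" "code A = code A'"
    then show "A = A'" using le[of A A'] le[of A' A] by auto
  qed
  \<comment> \<open>Each of \<open>D\<close> rows has a subset of the ground set, a bit and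
    \<open>K\<close> grid cells numbered 0 to \<open>N\<close>, where \<open>N\<close> equals
    \<open>C / \<epsilon>\<close>.\<close>
  define codes where "codes = PiE {..<D} (\<lambda>_. Pow {1..n} \<times> (UNIV :: bool set) \<times> PiE {..<K} (\<lambda>_. {..N}))"
  have "code A \<in> codes" if A: "A \<in> \<A>" for A
    unfolding code_def codes_def factorization_code_def restrict_PiE_iff
  proof (intro ballI SigmaI UNIV_I)
    fix j assume "j \<in> {..<D}"
    then have ej: "e A j \<subseteq> {1..n}" using e by simp
    then show "e A j \<in> Pow {1..n}" by simp
    show "restrict (\<lambda>i. nat \<lfloor>\<Lambda> A (e A j) i / \<epsilon>\<rfloor>) {..<K} \<in> PiE {..<K} (\<lambda>_. {..N})"
      unfolding restrict_PiE_iff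
    proof
      fix i assume "i \<in> {..<K}"
      then have "\<Lambda> A (e A j) i \<le> C"
        using nonneg_factorizationD(2)[OF \<Lambda>[OF A] ej] by simp
      then have "\<Lambda> A (e A j) i / \<epsilon> \<le> C / \<epsilon>" using \<epsilon>(1) by (simp add: divide_right_mono)
      also have "C / \<epsilon> = C * real (4 * (K + 1) * 2 ^ D)"
        unfolding \<epsilon>_def by (simp only: divide_divide_eq_right div_by_1)
      also have "\<dots> = real N" unfolding C_def N_def by (simp only: of_nat_mult)
      finally have "\<lfloor>\<Lambda> A (e A j) i / \<epsilon>\<rfloor> \<le> int N" by linarith
      then show "nat \<lfloor>\<Lambda> A (e A j) i / \<epsilon>\<rfloor> \<in> {..N}" by auto
    qed
  qed
  moreover have "finite codes" unfolding codes_def by (intro finite_PiE finite_cartesian_product) auto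
  ultimately have "card \<A> \<le> card codes"
    using card_inj_on_le[OF \<open>inj_on code \<A>\<close>] by blast
  moreover have "card \<A> = 2 ^ (2 ^ n - 1)"
    unfolding \<A>_def by (simp add: card_Pow card_Diff_subset)
  moreover have "card codes = (2 ^ n * (2 * (N + 1) ^ K)) ^ D"
    unfolding codes_def by (simp add: card_PiE card_cartesian_product card_Pow)
  ultimately show ?thesis by simp
qed

lemma ex_large_extension_complexity:
  assumes large: "8 * (n + K + 1) ^ 3 < (2::nat) ^ n - 1"
  shows "\<exists>A. {} \<notin> A \<and> K < xc (base_polytope n (set_function n A))"
proof (rule ccontr)
  assume neg: "\<not> ?thesis"
  define D where "D = n + K + 1"
  define N where "N = (n * n + 1) * (4 * (K + 1) * 2 ^ D)"
  have "xc (base_polytope n (set_function n A)) \<le> K" if "A \<subseteq> Pow {1..n} - {{}}" for A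
    using neg that by (metis DiffE insertI1 not_le subsetD)
  then have "(2::nat) ^ (2 ^ n - 1) \<le> (2 ^ n * (2 * (N + 1) ^ K)) ^ D"
    unfolding N_def by (intro code_count[OF D_def]) auto
  \<comment> \<open>Bounding \<open>n * n + 1\<close> by \<open>2 ^ D * 2 ^ D\<close> and
    \<open>K + 1\<close> by \<open>2 ^ D\<close> gives \<open>N + 1 \<le> 2 ^ (4 * D + 3)\<close>;
    since \<open>D \<ge> 1\<close>, the exponent is at most \<open>7 * D\<close>. The set and the
    bit add at most another \<open>D * D\<close> per row.\<close>
  also have "\<dots> \<le> (2 ^ n * (2 * (2 ^ (7 * D)) ^ K)) ^ D"
  proof (intro power_mono mult_left_mono)
    have D2: "D \<le> 2 ^ D" by (simp add: less_imp_le)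
    have "n * n + 1 \<le> D * D" unfolding D_def by (simp add: algebra_simps)
    also have "\<dots> \<le> 2 ^ D * 2 ^ D" using D2 by (intro mult_mono) auto
    finally have "n * n + 1 \<le> 2 ^ D * 2 ^ D" .
    moreover have "4 * (K + 1) * 2 ^ D \<le> 4 * 2 ^ D * 2 ^ D"
      using D2 unfolding D_def by (intro mult_mono) auto
    ultimately have "N \<le> (2 ^ D * 2 ^ D) * (4 * 2 ^ D * 2 ^ D)"
      unfolding N_def by (rule mult_mono) auto
    also have "\<dots> = 2 ^ (4 * D + 2)" by (simp add: power_add power_mult power4_eq_xxxx power2_eq_square mult.commute[of 4])
    finally have "N + 1 \<le> 2 ^ (4 * D + 2) + 1" by simp
    also have "\<dots> \<le> 2 ^ (4 * D + 2) + 2 ^ (4 * D + 2)" by simp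
    also have "\<dots> = 2 ^ (4 * D + 3)" by (simp add: power_add)
    also have "\<dots> \<le> 2 ^ (7 * D)" unfolding D_def by (intro power_increasing) auto
    finally show "N + 1 \<le> 2 ^ (7 * D)" .
  qed auto
  also have "\<dots> = 2 ^ ((n + 1 + 7 * D * K) * D)"
  proof -
    have "(2::nat) ^ n * (2 * (2 ^ (7 * D)) ^ K) = 2 ^ (n + 1 + 7 * D * K)"
      by (simp only: power_add power_one_right power_mult mult.assoc)
    then show ?thesis by (simp only: power_mult)
  qed
  finally have "2 ^ n - 1 \<le> (n + 1 + 7 * D * K) * D"
    by (simp only: power_increasing_iff)
  also have "\<dots> \<le> (D * D + 7 * D * D) * D"
  proof (intro mult_right_mono add_mono)
    have "n + 1 \<le> D" "1 \<le> D" unfolding D_def by auto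
    then show "n + 1 \<le> D * D" using mult_mono[of "n + 1" D 1 D] by simp
    show "7 * D * K \<le> 7 * D * D" by (intro mult_left_mono) (auto simp: D_def)
  qed simp
  also have "\<dots> = 8 * D ^ 3" by (simp add: power3_eq_cube algebra_simps)
  finally show False using large unfolding D_def by simp
qed

theorem theorem4p7:
  shows "(\<forall>n. polytope_in n (permutahedron n)) \<and>
    (\<exists>k::nat. (\<lambda>n. real (xc (permutahedron n))) \<in> O(\<lambda>n. real n ^ k)) \<and>
    (\<exists>S. (\<forall>n. minkowski_summand_in n (S n) (permutahedron n)) \<and>
         (\<exists>c>0. \<forall>\<^sub>F n in sequentially. real (xc (S n)) \<ge> 2 powr (c * real n)))"
proof (intro conjI)
  show "\<forall>n. polytope_in n (permutahedron n)" using polytope_in_permutahedron by blast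
  show "\<exists>k::nat. (\<lambda>n. real (xc (permutahedron n))) \<in> O(\<lambda>n. real n ^ k)"
  proof (intro exI[of _ 2] bigoI[of _ 5] always_eventually allI)
    fix n :: nat
    have "n * n + 4 * n \<le> 5 * (n * n)" by (cases n) auto
    then have "xc (permutahedron n) \<le> 5 * (n * n)" using xc_permutahedron_le[of n] by linarith
    then have "real (xc (permutahedron n)) \<le> real (5 * (n * n))" by (rule of_nat_mono)
    then show "norm (real (xc (permutahedron n))) \<le> 5 * norm (real n ^ 2)"
      by (simp add: power2_eq_square)
  qed
  \<comment> \<open>The exponent 1/4 keeps the cube of \<open>n + K n + 1\<close> of order
    \<open>2 powr (3 * n / 4)\<close>, below \<open>2 ^ n\<close>.\<close>
  define K where "K n = nat \<lfloor>2 powr (real n / 4)\<rfloor>" for n :: nat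
  \<comment> \<open>A summand is required for every \<open>n\<close>; where the counting condition
    fails, the empty family serves.\<close>
  have "\<forall>n. \<exists>A. {} \<notin> A \<and> (8 * (n + K n + 1) ^ 3 < (2::nat) ^ n - 1 \<longrightarrow>
      K n < xc (base_polytope n (set_function n A)))"
    using ex_large_extension_complexity by (metis empty_iff)
  then obtain A where A: "\<And>n. {} \<notin> A n"
    "\<And>n. 8 * (n + K n + 1) ^ 3 < (2::nat) ^ n - 1 \<Longrightarrow> K n < xc (base_polytope n (set_function n (A n)))"
    by metis
  have "\<forall>\<^sub>F n in sequentially. 8 * (real n + 2 powr (real n / 4) + 1) ^ 3 < 2 ^ n - 1"
    by real_asymp
  then have "\<forall>\<^sub>F n in sequentially. 2 powr (1 / 4 * real n) \<le> real (xc (base_polytope n (set_function n (A n))))"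
  proof (rule eventually_mono)
    fix n :: nat assume n: "8 * (real n + 2 powr (real n / 4) + 1) ^ 3 < 2 ^ n - 1"
    have "real (8 * (n + K n + 1) ^ 3) \<le> 8 * (real n + 2 powr (real n / 4) + 1) ^ 3"
      unfolding K_def of_nat_mult of_nat_power of_nat_add
      by (intro mult_mono power_mono add_mono) auto
    also have "\<dots> < real (2 ^ n - 1)" using n by (simp add: of_nat_diff)
    finally have "8 * (n + K n + 1) ^ 3 < (2::nat) ^ n - 1" by (simp only: of_nat_less_iff)
    then have "K n < xc (base_polytope n (set_function n (A n)))" by (rule A(2))
    \<comment> \<open>Exceeding the floor by at least 1 makes up for the rounding in
      \<open>K n\<close>.\<close>
    then have "real (K n) + 1 \<le> real (xc (base_polytope n (set_function n (A n))))" by linarith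
    moreover have "2 powr (real n / 4) \<le> real (K n) + 1" unfolding K_def by linarith
    ultimately show "2 powr (1 / 4 * real n) \<le> real (xc (base_polytope n (set_function n (A n))))"
      by simp
  qed
  then show "\<exists>S. (\<forall>n. minkowski_summand_in n (S n) (permutahedron n)) \<and>
      (\<exists>c>0. \<forall>\<^sub>F n in sequentially. real (xc (S n)) \<ge> 2 powr (c * real n))"
    using summand_of_permutahedron[OF A(1)]
    by (intro exI[of _ "\<lambda>n. base_polytope n (set_function n (A n))"] conjI allI exI[of _ "1/4"]) auto
qed

end
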